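(* Let $N\ge 3$. Let $V:(0,+\infty)\to[0,+\infty)$ and $K:(0,+\infty)\to(0,+\infty)$ be continuous, and assume that there is $C>0$ such that $V(r)\le C/r^2$ for all $r\in(0,1)$. Assume that there exists $R_2>0$ such that $$\sup_{r>R_2}\frac{K(r)}{r^{\alpha_\infty}V(r)^{\beta_\infty}}<+\infty\quad\text{for some } 0\le\beta_\infty\le 1 \text{ and } \alpha_\infty\in\mathbb{R}.$$ Then $\lim_{R\to+\infty}\mathcal{S}_\infty(q_2,R)=0$ for every $q_2\in\mathbb{R}$ such that $$q_2>\max\{1,2\beta_\infty,q_\infty^*(\alpha_\infty,\beta_\infty)\}.$$
   Context: $f\in C^\infty(\mathbb{R},\mathbb{R})$ denotes the unique solution of the Cauchy problem $f'(t)=\frac{1}{\sqrt{1+2f(t)^2}}$ for $t\in\mathbb{R}$, $f(0)=0$. $C^\infty_{c,r}(\mathbb{R}^N)$ is the space of radial $C^\infty$ real functions with compact support in $\mathbb{R}^N$, and $D^{1,2}_r(\mathbb{R}^N)$ is its closure with respect to the norm $\|u\|_{1,2}=\left(\int_{\mathbb{R}^N}|\nabla u|^2dx\right)^{1/2}$. $E=\{u\in D^{1,2}_r(\mathbb{R}^N): \int_{\mathbb{R}^N}V(|x|)f(u)^2dx<+\infty\}$, endowed with the norm $\|u\|=\|u\|_{1,2}+\|u\|_o$, where $\|u\|_o=\inf_{k>0}\frac1k\left[1+\int_{\mathbb{R}^N}V(|x|)f(ku)^2dx\right]$; it is a Banach space. $B_R=\{x\in\mathbb{R}^N:|x|<R\}$.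 For $R>0$ and $q>1$, $\mathcal{S}_\infty(q,R)=\sup_{u\in E,\,\|u\|=1}\int_{\mathbb{R}^N\setminus B_R}K(|x|)|u|^q\,dx\in[0,+\infty]$. For $\alpha\in\mathbb{R}$, $\beta\in[0,1]$: $q_\infty^*(\alpha,\beta)=2\,\frac{\alpha+N-2\beta}{N-2}$. Convention: $V(r)^0=1$ for every $r$ (even if $V(r)=0$); a quotient $K(r)/(r^\alpha V(r)^\beta)$ with $\beta>0$ and $V(r)=0$ is understood as $+\infty$. *)

theory Defs
  imports "HOL-Analysis.Analysis"
begin

section \<open>The solution of the Cauchy problem\<close>

definition solves_Cauchy :: "(real \<Rightarrow> real) \<Rightarrow> bool" where
  "solves_Cauchy f \<longleftrightarrow>
     (\<forall>t. (f has_real_derivative 1 / sqrt (1 + 2 * (f t)\<^sup>2)) (at t)) \<and> f 0 = 0"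

definition f_sol :: "real \<Rightarrow> real" where
  "f_sol = (THE f. solves_Cauchy f)"

lemma ex1_solves_Cauchy: "\<exists>!f. solves_Cauchy f"
proof -
  define F :: "real \<Rightarrow> real" where
    "F s = s * sqrt (1 + 2 * s\<^sup>2) / 2 + arsinh (sqrt 2 * s) / (2 * sqrt 2)" for s
  have pos: "1 + 2 * s\<^sup>2 > 0" for s :: real
    using zero_le_power2[of s] by linarith
  have dF: "(F has_real_derivative sqrt (1 + 2 * s\<^sup>2)) (at s)" for s
  proof -
    define r where "r = sqrt (1 + 2 * s\<^sup>2)"
    have r: "r > 0" "r * r = 1 + 2 * s\<^sup>2" "sqrt ((sqrt 2 * s)\<^sup>2 + 1) = r"
      using pos[of s] by (auto simp: r_def power_mult_distrib add.commute)
    have "(F has_real_derivative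
        (sqrt (1 + 2 * s\<^sup>2) + s * ((4 * s) * (inverse (sqrt (1 + 2 * s\<^sup>2)) / 2))) / 2
        + (1 / sqrt ((sqrt 2 * s)\<^sup>2 + 1)) * sqrt 2 / (2 * sqrt 2)) (at s)"
      unfolding F_def using pos[of s]
      by (auto intro!: derivative_eq_intros DERIV_chain2[OF arsinh_real_has_field_derivative]
               simp: field_simps)
    also have "(sqrt (1 + 2 * s\<^sup>2) + s * ((4 * s) * (inverse (sqrt (1 + 2 * s\<^sup>2)) / 2))) / 2
        + (1 / sqrt ((sqrt 2 * s)\<^sup>2 + 1)) * sqrt 2 / (2 * sqrt 2) = r"
      unfolding r(3) r_def[symmetric] using r(1,2)
      by (simp add: field_simps power2_eq_square)
    finally show ?thesis by (simp add: r_def)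
  qed
  have expand: "F b - F a \<ge> b - a" if "a \<le> b" for a b
  proof -
    have "F a - a \<le> F b - b"
    proof (rule DERIV_nonneg_imp_nondecreasing[OF that])
      fix x
      have "((\<lambda>s. F s - s) has_real_derivative sqrt (1 + 2 * x\<^sup>2) - 1) (at x)"
        by (intro derivative_intros dF)
      then show "\<exists>y. ((\<lambda>s. F s - s) has_real_derivative y) (at x) \<and> 0 \<le> y"
        by (intro exI[of _ "sqrt (1 + 2 * x\<^sup>2) - 1"]) auto
    qed
    then show ?thesis by simp
  qed
  have injF: "inj F"
  proof (rule injI)
    fix a b assume "F a = F b"
    then show "a = b" using expand[of a b] expand[of b a] by linarith
  qed
  have F0: "F 0 = 0" by (simp add: F_def)
  have contF: "isCont F x" for x
    using dF DERIV_isCont by blast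
  have surjF: "\<exists>x. F x = t" for t
  proof -
    have "\<exists>x. -\<bar>t\<bar> \<le> x \<and> x \<le> \<bar>t\<bar> \<and> F x = t"
    proof (rule IVT)
      show "F (-\<bar>t\<bar>) \<le> t" using expand[of "-\<bar>t\<bar>" 0] F0 by linarith
      show "t \<le> F \<bar>t\<bar>" using expand[of 0 "\<bar>t\<bar>"] F0 by linarith
    qed (use contF in auto)
    then show ?thesis by blast
  qed
  define g where "g = inv F"
  have gF: "g (F x) = x" for x using injF by (simp add: g_def)
  have Fg: "F (g t) = t" for t unfolding g_def using surjF by (metis f_inv_into_f rangeI)
  have contg: "isCont g t" for t
  proof -
    have "isCont g (F (g t))"
      by (rule isCont_inverse_function[where d = 1]) (auto simp: gF contF)
    then show ?thesis by (simp add: Fg)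
  qed
  have "solves_Cauchy g"
    unfolding solves_Cauchy_def
  proof (intro conjI allI)
    fix t
    have "(g has_real_derivative inverse (sqrt (1 + 2 * (g t)\<^sup>2))) (at t)"
      by (rule DERIV_inverse_function[where f = F and a = "t - 1" and b = "t + 1"])
         (use dF pos[of "g t"] in \<open>auto simp: Fg contg\<close>)
    then show "(g has_real_derivative 1 / sqrt (1 + 2 * (g t)\<^sup>2)) (at t)"
      by (simp add: inverse_eq_divide)
    show "g 0 = 0" using gF[of 0] F0 by simp
  qed
  moreover have "h = g" if h: "solves_Cauchy h" for h
  proof
    fix t
    have "((\<lambda>t. F (h t) - t) has_real_derivative 0) (at x)" for x
    proof -
      have "((\<lambda>t. F (h t) - t) has_real_derivative
          sqrt (1 + 2 * (h x)\<^sup>2) * (1 / sqrt (1 + 2 * (h x)\<^sup>2)) - 1) (at x)"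
        using h unfolding solves_Cauchy_def
        by (intro derivative_intros DERIV_chain2[OF dF]) auto
      then show ?thesis using pos[of "h x"] by simp
    qed
    then have "F (h t) - t = F (h 0) - 0"
      using DERIV_isconst_all[of "\<lambda>t. F (h t) - t"] by blast
    then have "F (h t) = t" using h F0 by (simp add: solves_Cauchy_def)
    then show "h t = g t" using gF by metis
  qed
  ultimately show ?thesis by blast
qed

lemma f_sol_solves: "solves_Cauchy f_sol"
  unfolding f_sol_def by (rule theI'[OF ex1_solves_Cauchy])

section \<open>Radial test functions\<close>

fun Ck :: "nat \<Rightarrow> (real ^ 'n \<Rightarrow> real) \<Rightarrow> bool" where
  "Ck 0 \<phi> \<longleftrightarrow> continuous_on UNIV \<phi>"
| "Ck (Suc k) \<phi> \<longleftrightarrow> (\<forall>x. \<phi> differentiable (at x)) \<and>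
     (\<forall>v. Ck k (\<lambda>x. frechet_derivative \<phi> (at x) v))"

definition Cc_infty :: "(real ^ 'n \<Rightarrow> real) set" where
  "Cc_infty = {\<phi>. (\<forall>k. Ck k \<phi>) \<and> compact (closure {x. \<phi> x \<noteq> 0})}"

definition Cc_infty_r :: "(real ^ 'n \<Rightarrow> real) set" where
  "Cc_infty_r = {\<phi> \<in> Cc_infty. \<forall>x y. norm x = norm y \<longrightarrow> \<phi> x = \<phi> y}"

section \<open>The spaces $D^{1,2}$ and $D^{1,2}_r$\<close>

definition locally_integrable :: "(real ^ 'n \<Rightarrow> 'b::{banach, second_countable_topology}) \<Rightarrow> bool" where
  "locally_integrable u \<longleftrightarrow>
     u \<in> borel_measurable lborel \<and> (\<forall>S. compact S \<longrightarrow> set_integrable lborel S u)"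

definition has_weak_gradient :: "(real ^ 'n \<Rightarrow> real) \<Rightarrow> (real ^ 'n \<Rightarrow> real ^ 'n) \<Rightarrow> bool" where
  "has_weak_gradient u G \<longleftrightarrow> locally_integrable u \<and> locally_integrable G \<and>
     (\<forall>\<phi>\<in>Cc_infty. \<forall>i.
        (\<integral>x. u x * frechet_derivative \<phi> (at x) (axis i 1) \<partial>lborel) = - (\<integral>x. G x $ i * \<phi> x \<partial>lborel))"

text \<open>The weak gradient is unique up to null sets, so no integral depends on the choice.\<close>

definition weak_gradient :: "(real ^ 'n \<Rightarrow> real) \<Rightarrow> real ^ 'n \<Rightarrow> real ^ 'n" where
  "weak_gradient u = (SOME G. has_weak_gradient u G)"

text \<open>The ambient space in which the closure of the radial test functions is taken:
  functions in $L^{2N/(N-2)}$ (for $N \ge 3$) with weak gradient in $L^2$.  The summability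
  of \<open>u\<close> excludes the nonzero constants, so that \<open>norm12\<close> is a norm modulo null sets.
  Elements are represented by Borel functions, not by classes modulo null sets.\<close>

definition D12 :: "(real ^ 'n \<Rightarrow> real) set" where
  "D12 = {u. u \<in> borel_measurable lborel \<and>
     integrable lborel (\<lambda>x. \<bar>u x\<bar> powr (2 * real CARD('n) / (real CARD('n) - 2))) \<and>
     (\<exists>G. has_weak_gradient u G \<and> integrable lborel (\<lambda>x. (norm (G x))\<^sup>2))}"

definition norm12 :: "(real ^ 'n \<Rightarrow> real) \<Rightarrow> real" where
  "norm12 u = sqrt (\<integral>x. (norm (weak_gradient u x))\<^sup>2 \<partial>lborel)"

definition D12_r :: "(real ^ 'n \<Rightarrow> real) set" where
  "D12_r = {u \<in> D12. \<forall>\<epsilon>>0. \<exists>\<phi>\<in>Cc_infty_r. norm12 (\<lambda>x. u x - \<phi> x) < \<epsilon>}"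

section \<open>The space $E$\<close>

text \<open>Integrals of nonnegative functions take values in \<open>[0, \<infinity>]\<close>.  The value of \<open>V\<close> at
  \<open>0\<close>, used only at the origin of $R^N$, is irrelevant.\<close>

definition modular :: "(real \<Rightarrow> real) \<Rightarrow> (real ^ 'n \<Rightarrow> real) \<Rightarrow> ennreal" where
  "modular V u = (\<integral>\<^sup>+x. ennreal (V (norm x) * (f_sol (u x))\<^sup>2) \<partial>lborel)"

definition E :: "(real \<Rightarrow> real) \<Rightarrow> (real ^ 'n \<Rightarrow> real) set" where
  "E V = {u \<in> D12_r. modular V u < \<infinity>}"

definition norm_o :: "(real \<Rightarrow> real) \<Rightarrow> (real ^ 'n \<Rightarrow> real) \<Rightarrow> ennreal" where
  "norm_o V u = (INF k\<in>{0<..}. ennreal (1 / k) * (1 + modular V (\<lambda>x. k * u x)))"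

definition norm_E :: "(real \<Rightarrow> real) \<Rightarrow> (real ^ 'n \<Rightarrow> real) \<Rightarrow> ennreal" where
  "norm_E V u = ennreal (norm12 u) + norm_o V u"

section \<open>The function $S_\infty$ and the exponent $q^*_\infty$\<close>

text \<open>The first argument only carries the dimension \<open>N = CARD('n)\<close>.\<close>

definition S_infty ::
  "'n::finite itself \<Rightarrow> (real \<Rightarrow> real) \<Rightarrow> (real \<Rightarrow> real) \<Rightarrow> real \<Rightarrow> real \<Rightarrow> ennreal" where
  "S_infty _ V K q R = (SUP u\<in>{u \<in> (E V :: (real ^ 'n \<Rightarrow> real) set). norm_E V u = 1}.
     (\<integral>\<^sup>+x\<in>- ball 0 R. ennreal (K (norm x) * \<bar>u x\<bar> powr q) \<partial>lborel))"

definition q_infty_star :: "nat \<Rightarrow> real \<Rightarrow> real \<Rightarrow> real" where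
  "q_infty_star N \<alpha> \<beta> = 2 * ((\<alpha> + real N - 2 * \<beta>) / (real N - 2))"

text \<open>The library has \<open>0 powr 0 = 0\<close>, whereas here \<open>v\<close> to the power \<open>0\<close> is \<open>1\<close> for
  every \<open>v\<close>, including \<open>v = 0\<close>.\<close>

definition vpow :: "real \<Rightarrow> real \<Rightarrow> real" where
  "vpow v \<beta> = (if \<beta> = 0 then 1 else v powr \<beta>)"

text \<open>Division is in \<^typ>\<open>ennreal\<close>, where \<open>a / 0 = \<infinity>\<close> for \<open>a > 0\<close>; hence the value is \<open>\<infinity>\<close>
  if \<open>\<beta> > 0\<close>, \<open>V r = 0\<close> and \<open>K r > 0\<close>.\<close>

definition KV_quotient ::
  "(real \<Rightarrow> real) \<Rightarrow> (real \<Rightarrow> real) \<Rightarrow> real \<Rightarrow> real \<Rightarrow> real \<Rightarrow> ennreal" where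
  "KV_quotient V K \<alpha> \<beta> r = ennreal (K r) / ennreal (r powr \<alpha> * vpow (V r) \<beta>)"

end

theory Submission
  imports Defs
begin

text \<open>
  Fix \<open>u \<in> E\<close> with \<open>\<parallel>u\<parallel> = 1\<close> and put \<open>N = CARD('n)\<close>, \<open>\<gamma> = (N - 2) / 2\<close>.  Two estimates with constants
  that do not depend on \<open>u\<close> carry the proof.

  First, \<open>\<bar>u x\<bar> \<le> D * \<bar>x\<bar> powr - \<gamma>\<close> for almost every \<open>x\<close> (\<open>D12_r_decay\<close>), so that \<open>\<bar>u\<bar> \<le> 1\<close> outside a
  large ball.  Second, where \<open>\<bar>u\<bar> \<le> 1\<close> the integrand of the modular dominates \<open>V * u\<^sup>2\<close>, because
  \<open>f_sol t\<^sup>2\<close> is at least \<open>min (t\<^sup>2) \<bar>t\<bar> / 3\<close>; hence the integral of \<open>V * u\<^sup>2\<close> over the complement of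
  that ball is at most \<open>12\<close> (\<open>tail_integral_le_12\<close>).

  With \<open>r = \<bar>x\<bar>\<close> and \<open>\<Lambda>\<close> the supremum of the quotient, one has \<open>K * \<bar>u\<bar>\<^sup>q \<le> \<Lambda> * r\<^sup>\<alpha> * V\<^sup>\<beta> * \<bar>u\<bar>\<^sup>q\<close>.  Estimating
  \<open>q - 2 * \<beta> \<ge> 0\<close> of the \<open>q\<close> factors \<open>\<bar>u\<bar>\<close> by the decay bound leaves, up to a constant,
  \<open>r powr - \<delta> * (V * u\<^sup>2)\<^sup>\<beta> * (r powr - N) powr (1 - \<beta>)\<close> where \<open>\<delta> = \<gamma> * (q - q\<^sub>\<infinity>\<^sup>*)\<close> is positive
  exactly because \<open>q\<close> exceeds the critical exponent.  Since \<open>a\<^sup>\<beta> * b powr (1 - \<beta>) \<le> a + b\<close>, this is at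
  most \<open>R powr - (\<delta>/2) * (V * u\<^sup>2 + r powr (- N - \<delta>/2))\<close> on \<open>r \<ge> R \<ge> 1\<close>, and the bracket has a
  uniformly bounded integral.

  For a radial test function the decay bound follows by integrating the radial derivative from \<open>\<bar>x\<bar>\<close>
  to infinity, the inequality of arithmetic and geometric means, and integration in polar coordinates.
  It passes to \<open>u\<close> by duality: a product bump \<open>b\<close> minus a
  translate of it along a coordinate axis is a partial derivative of a test function, so the
  integral of \<open>(u - \<phi>) * (b - b\<^sub>h)\<close> is small when \<open>\<nabla>(u - \<phi>)\<close> is small in \<open>L\<^sup>2\<close>.  Here \<open>\<phi>\<close> is a radial
  test function obeying the decay bound, and the integral of \<open>u * b\<^sub>h\<close> vanishes as \<open>h \<rightarrow> \<infinity>\<close>, since \<open>u\<close>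
  lies in a Lebesgue space.  This bounds the averages of \<open>u\<close> over boxes, and Lebesgue differentiation
  gives the pointwise bound.  The same bumps show that weak gradients are unique, so that \<open>norm12\<close>
  can be computed from any of them.
\<close>

section \<open>Growth of the solution of the Cauchy problem\<close>

lemma f_sol_has_derivative:
  "(f_sol has_real_derivative 1 / sqrt (1 + 2 * (f_sol t)\<^sup>2)) (at t)"
  using f_sol_solves by (simp add: solves_Cauchy_def)

lemma f_sol_0: "f_sol 0 = 0"
  using f_sol_solves by (simp add: solves_Cauchy_def)

lemma f_sol_measurable [measurable]: "f_sol \<in> borel_measurable borel"
  by (intro borel_measurable_continuous_onI DERIV_continuous_on[of _ f_sol])
     (use f_sol_has_derivative DERIV_subset in blast)

text \<open>The function \<open>t \<mapsto> f_sol t * sqrt (1 + 2 * (f_sol t)\<^sup>2)\<close> has derivative at least \<open>1\<close> and vanishes at \<open>0\<close>.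
This is the source of all lower bounds for \<open>f_sol\<close>.\<close>

lemma f_sol_expands: "\<bar>t\<bar> \<le> \<bar>f_sol t\<bar> * sqrt (1 + 2 * (f_sol t)\<^sup>2)"
proof -
  define h where "h t = f_sol t * sqrt (1 + 2 * (f_sol t)\<^sup>2)" for t
  have pos: "1 + 2 * (f_sol t)\<^sup>2 > 0" for t
    using zero_le_power2[of "f_sol t"] by linarith
  have dh: "(h has_real_derivative 1 + 2 * (f_sol t)\<^sup>2 / (1 + 2 * (f_sol t)\<^sup>2)) (at t)" for t
  proof -
    define s where "s = f_sol t"
    define r where "r = sqrt (1 + 2 * s\<^sup>2)"
    have r: "r > 0" "r * r = 1 + 2 * s\<^sup>2"
      using pos[of t] by (auto simp: r_def s_def)
    have "(h has_real_derivative
       f_sol t * ((2 * (2 * f_sol t * (1 / sqrt (1 + 2 * (f_sol t)\<^sup>2)))) *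
           (inverse (sqrt (1 + 2 * (f_sol t)\<^sup>2)) / 2))
       + (1 / sqrt (1 + 2 * (f_sol t)\<^sup>2)) * sqrt (1 + 2 * (f_sol t)\<^sup>2)) (at t)"
      unfolding h_def using pos[of t]
      by (auto intro!: derivative_eq_intros f_sol_has_derivative)
    also have "f_sol t * ((2 * (2 * f_sol t * (1 / sqrt (1 + 2 * (f_sol t)\<^sup>2)))) *
           (inverse (sqrt (1 + 2 * (f_sol t)\<^sup>2)) / 2))
       + (1 / sqrt (1 + 2 * (f_sol t)\<^sup>2)) * sqrt (1 + 2 * (f_sol t)\<^sup>2)
       = 1 + 2 * s * s / (r * r)"
      unfolding s_def[symmetric] r_def[symmetric] using r(1) by (simp add: field_simps)
    finally show ?thesis
      unfolding r by (simp add: s_def power2_eq_square mult.assoc)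
  qed
  have mono: "h a - a \<le> h b - b" if "a \<le> b" for a b
  proof (rule DERIV_nonneg_imp_nondecreasing[OF that])
    fix x
    have "((\<lambda>t. h t - t) has_real_derivative
      (1 + 2 * (f_sol x)\<^sup>2 / (1 + 2 * (f_sol x)\<^sup>2)) - 1) (at x)"
      by (intro derivative_intros dh)
    then show "\<exists>y. ((\<lambda>t. h t - t) has_real_derivative y) (at x) \<and> 0 \<le> y"
      using pos[of x] by (intro exI conjI) auto
  qed
  have "\<bar>t\<bar> \<le> \<bar>h t\<bar>"
    using mono[of 0 t] mono[of t 0] f_sol_0 by (auto simp: h_def abs_real_def)
  then show ?thesis using pos[of t] by (simp add: h_def abs_mult)
qed

text \<open>By \<open>f_sol_expands\<close>, \<open>\<bar>t\<bar>\<close> is bounded by a multiple of \<open>\<bar>f_sol t\<bar>\<close> while \<open>\<bar>f_sol t\<bar> \<le> 1\<close>, and by a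
multiple of \<open>(f_sol t)\<^sup>2\<close> afterwards: \<open>f_sol\<close> is linear near \<open>0\<close> and of square root growth at infinity.\<close>

lemma f_sol_lower_bound: "min (t\<^sup>2) \<bar>t\<bar> \<le> 3 * (f_sol t)\<^sup>2"
proof -
  define s where "s = \<bar>f_sol t\<bar>"
  have s0: "s \<ge> 0" and t: "\<bar>t\<bar> \<le> s * sqrt (1 + 2 * s\<^sup>2)"
    using f_sol_expands[of t] by (auto simp: s_def)
  show ?thesis
  proof (cases "s \<le> 1")
    case True
    have "t\<^sup>2 = \<bar>t\<bar>\<^sup>2" by simp
    also have "\<dots> \<le> (s * sqrt (1 + 2 * s\<^sup>2))\<^sup>2"
      by (intro power_mono t) auto
    also have "\<dots> = s\<^sup>2 * (1 + 2 * s\<^sup>2)"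
      by (simp add: power_mult_distrib)
    also have "\<dots> \<le> s\<^sup>2 * 3"
      using power_mono[OF True s0, of 2] by (intro mult_left_mono) auto
    finally show ?thesis by (simp add: s_def)
  next
    case False
    then have "1 \<le> s\<^sup>2" by (simp add: one_le_power)
    then have "sqrt (1 + 2 * s\<^sup>2) \<le> sqrt ((3 * s)\<^sup>2)"
      by (intro real_sqrt_le_mono) (simp add: power_mult_distrib)
    also have "\<dots> = 3 * s" using s0 by (simp only: real_sqrt_abs)
    finally have "\<bar>t\<bar> \<le> s * (3 * s)"
      using t s0 by (meson mult_left_mono order_trans)
    then show ?thesis by (simp add: s_def power2_eq_square)
  qed
qed

section \<open>The modular controls the weighted tail\<close>

text \<open>The value of \<open>V\<close> at \<open>0\<close> is arbitrary, so measurability of \<open>V (norm x)\<close> is only claimed away from the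
origin.\<close>

lemma radial_outside_ball_measurable:
  fixes V :: "real \<Rightarrow> real"
  assumes "continuous_on {0<..} V" "R > 0"
  shows "(\<lambda>x::real^'n. indicator (- ball 0 R) x * V (norm x)) \<in> borel_measurable borel"
proof -
  have "(\<lambda>x::real^'n. indicator (- ball 0 R) x *\<^sub>R V (norm x)) \<in> borel_measurable borel"
    using \<open>R > 0\<close>
    by (intro borel_measurable_continuous_on_indicator
        continuous_on_compose2[OF assms(1)] continuous_intros) auto
  then show ?thesis by simp
qed

text \<open>If \<open>norm_o V u \<le> 1\<close>, some \<open>k\<close> has \<open>1 + modular V (k u) < 2 * k\<close>, hence \<open>k > 1/2\<close>.  The possible size
of \<open>k\<close> does no harm: where \<open>\<bar>u\<bar> \<le> 1\<close>, both terms of \<open>min ((k u)\<^sup>2) \<bar>k u\<bar>\<close> are at least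
\<open>k * u\<^sup>2 / 2\<close>, so the factor \<open>k\<close> cancels and \<open>6 / k * (2 * k) = 12\<close>.\<close>

lemma tail_integral_le_12:
  fixes u :: "real^'n \<Rightarrow> real"
  assumes V: "continuous_on {0<..} V" "\<And>r. r > 0 \<Longrightarrow> V r \<ge> 0"
    and u[measurable]: "u \<in> borel_measurable lborel"
    and o: "norm_o V u \<le> 1" and R: "R > 0"
    and small: "AE x in lborel. norm x \<ge> R \<longrightarrow> \<bar>u x\<bar> \<le> 1"
  shows "(\<integral>\<^sup>+x\<in>- ball 0 R. ennreal (V (norm x) * (u x)\<^sup>2) \<partial>lborel) \<le> 12"
proof -
  have "norm_o V u < 2" using o by (rule le_less_trans) simp
  then obtain k where k: "k > 0"
      and less: "ennreal (1 / k) * (1 + modular V (\<lambda>x. k * u x)) < 2"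
    unfolding norm_o_def by (auto simp: INF_less_iff)
  define m where "m = modular V (\<lambda>x. k * u x)"
  have fin: "m \<noteq> \<infinity>"
    using less k by (auto simp: m_def[symmetric] ennreal_mult_top)
  define m' where "m' = enn2real m"
  have m': "m = ennreal m'" "m' \<ge> 0"
    using fin by (auto simp: m'_def less_top)
  have "1 + ennreal m' = ennreal (1 + m')"
    using m' by (simp add: ennreal_plus)
  then have "ennreal (1 / k) * (1 + ennreal m') = ennreal (1 / k * (1 + m'))"
    using k m' ennreal_mult[of "1 / k" "1 + m'"] by simp
  with less have "1 / k * (1 + m') < 2"
    using k m' by (simp add: m_def[symmetric] ennreal_less_iff flip: ennreal_numeral)
  then have km: "1 + m' < 2 * k" using k by (simp add: field_simps)
  then have k2: "k > 1 / 2" using m' by simp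
  have pw: "u0\<^sup>2 \<le> 6 / k * (f_sol (k * u0))\<^sup>2" if "\<bar>u0\<bar> \<le> 1" for u0
  proof -
    have sq: "u0\<^sup>2 \<le> \<bar>u0\<bar>"
      using that mult_left_mono[of "\<bar>u0\<bar>" 1 "\<bar>u0\<bar>"] by (simp add: power2_eq_square)
    have "k * u0\<^sup>2 \<le> 2 * (k * u0)\<^sup>2"
    proof -
      have "k * u0\<^sup>2 * 1 \<le> k * u0\<^sup>2 * (2 * k)" using k2 k by (intro mult_left_mono) auto
      then show ?thesis by (simp add: power2_eq_square algebra_simps)
    qed
    moreover have "k * u0\<^sup>2 \<le> \<bar>k * u0\<bar>"
      using sq k by (simp add: abs_mult)
    ultimately have "k * u0\<^sup>2 \<le> 2 * min ((k * u0)\<^sup>2) \<bar>k * u0\<bar>" by (auto simp: min_def)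
    also have "\<dots> \<le> 6 * (f_sol (k * u0))\<^sup>2" using f_sol_lower_bound[of "k * u0"] by simp
    finally show ?thesis using k by (simp add: field_simps)
  qed
  have Vm[measurable]: "(\<lambda>x::real^'n. indicator (- ball 0 R) x * V (norm x)) \<in> borel_measurable borel"
    by (rule radial_outside_ball_measurable[OF V(1) R])
  have "(\<integral>\<^sup>+x\<in>- ball 0 R. ennreal (V (norm x) * (u x)\<^sup>2) \<partial>lborel)
      \<le> (\<integral>\<^sup>+x. ennreal (6 / k) * ennreal (indicator (- ball 0 R) x * V (norm x) * (f_sol (k * u x))\<^sup>2) \<partial>lborel)"
  proof (rule nn_integral_mono_AE, use small in eventually_elim)
    case (elim x)
    show ?case
    proof (cases "x \<in> - ball 0 R")
      case True
      then have x: "norm x \<ge> R" "norm x > 0" using R by auto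
      then have "V (norm x) * (u x)\<^sup>2 \<le> V (norm x) * (6 / k * (f_sol (k * u x))\<^sup>2)"
        using elim V(2)[of "norm x"] by (intro mult_left_mono pw) auto
      then have "ennreal (V (norm x) * (u x)\<^sup>2) \<le> ennreal (6 / k * (V (norm x) * (f_sol (k * u x))\<^sup>2))"
        by (intro ennreal_leI) (simp add: algebra_simps)
      also have "\<dots> = ennreal (6 / k) * ennreal (V (norm x) * (f_sol (k * u x))\<^sup>2)"
        using k V(2)[of "norm x"] x by (intro ennreal_mult) auto
      finally show ?thesis using True by simp
    qed simp
  qed
  also have "\<dots> = ennreal (6 / k) *
      (\<integral>\<^sup>+x. ennreal (indicator (- ball 0 R) x * V (norm x) * (f_sol (k * u x))\<^sup>2) \<partial>lborel)"
    by (rule nn_integral_cmult) measurable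
  also have "\<dots> \<le> ennreal (6 / k) * m"
    unfolding m_def modular_def
    by (intro mult_left_mono nn_integral_mono) (auto split: split_indicator)
  also have "\<dots> \<le> ennreal (6 / k) * ennreal (2 * k)"
    using km m' by (intro mult_left_mono) (auto intro!: ennreal_leI)
  also have "\<dots> = ennreal (6 / k * (2 * k))" using k by (intro ennreal_mult[symmetric]) auto
  also have "\<dots> = 12" using k by simp
  finally show ?thesis .
qed

section \<open>Integrals of radial functions\<close>

text \<open>Polar coordinates for radial functions.  Both measures give \<open>{..a}\<close> the volume of the ball of radius
\<open>a\<close>, and these half-lines form an intersection-stable generator of the Borel sets.\<close>

lemma distr_norm_lborel:
  "distr (lborel :: (real^'n) measure) borel norm =
   density lborel (\<lambda>s. ennreal (real CARD('n) * unit_ball_vol (real CARD('n)) * s ^ (CARD('n) - 1))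
     * indicator {0..} s)" (is "?M = ?D")
proof -
  define N where "N = CARD('n)"
  define w where "w = unit_ball_vol (real N)"
  have N: "N > 0" by (simp add: N_def)
  have w: "w \<ge> 0" by (simp add: w_def)
  have M: "emeasure ?M {..a} = (if a < 0 then 0 else ennreal (w * a ^ N))" for a
  proof (cases "a < 0")
    case True
    then have "norm -` {..a} = ({} :: (real^'n) set)"
      using norm_ge_zero order_trans not_less by (auto, smt (verit))
    then show ?thesis using True by (simp add: emeasure_distr)
  next
    case False
    have "norm -` {..a} = (cball 0 a :: (real^'n) set)" by auto
    then show ?thesis using False
      by (simp add: emeasure_distr emeasure_cball w_def N_def)
  qed
  have D: "emeasure ?D {..a} = (if a < 0 then 0 else ennreal (w * a ^ N))" for a
  proof -
    have "emeasure ?D {..a} = (\<integral>\<^sup>+s. ennreal (N * w * s ^ (N - 1)) * indicator {0..a} s \<partial>lborel)"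
      by (subst emeasure_density)
         (auto simp: N_def w_def intro!: nn_integral_cong split: split_indicator)
    also have "\<dots> = (if a < 0 then 0 else ennreal (w * a ^ N))"
    proof (cases "a < 0")
      case False
      have "(\<integral>\<^sup>+s. ennreal (N * w * s ^ (N - 1)) * indicator {0..a} s \<partial>lborel)
          = ennreal (w * a ^ N - w * 0 ^ N)"
        using False N w
        by (intro nn_integral_FTC_Icc) (auto intro!: derivative_eq_intros)
      then show ?thesis using False N by (simp only: zero_power) simp
    qed (auto simp: )
    finally show ?thesis .
  qed
  show ?thesis
  proof (rule measure_eqI_generator_eq[where E = "range (\<lambda>a::real. {..a})" and \<Omega> = UNIV
        and A = "\<lambda>i. {..real i}"])
    show "Int_stable (range (\<lambda>a::real. {..a}))"
      by (auto simp: Int_stable_def)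
    show "(\<Union>i. {..real i}) = UNIV" using real_arch_simple by auto
    show "emeasure ?M {..real i} \<noteq> \<infinity>" for i by (simp add: M)
    show "sets ?M = sigma_sets UNIV (range (\<lambda>a::real. {..a}))"
      by (simp add: borel_eq_atMost)
    show "sets ?D = sigma_sets UNIV (range (\<lambda>a::real. {..a}))"
      by (simp add: borel_eq_atMost)
    show "emeasure ?M X = emeasure ?D X" if "X \<in> range (\<lambda>a::real. {..a})" for X
      using that unfolding image_iff by (elim bexE) (simp only: M D)
  qed auto
qed

lemma nn_integral_radial:
  fixes h :: "real \<Rightarrow> ennreal"
  assumes [measurable]: "h \<in> borel_measurable borel"
  shows "(\<integral>\<^sup>+x. h (norm (x :: real^'n)) \<partial>lborel) =
    (\<integral>\<^sup>+s. ennreal (real CARD('n) * unit_ball_vol (real CARD('n)) * s ^ (CARD('n) - 1))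
      * indicator {0..} s * h s \<partial>lborel)"
proof -
  have "(\<integral>\<^sup>+x. h (norm (x :: real^'n)) \<partial>lborel) = (\<integral>\<^sup>+s. h s \<partial>distr (lborel :: (real^'n) measure) borel norm)"
    by (simp add: nn_integral_distr)
  also have "\<dots> = (\<integral>\<^sup>+s. ennreal (real CARD('n) * unit_ball_vol (real CARD('n)) * s ^ (CARD('n) - 1))
      * indicator {0..} s * h s \<partial>lborel)"
    unfolding distr_norm_lborel by (subst nn_integral_density) auto
  finally show ?thesis .
qed

lemma power_integral_Ici:
  assumes "a > 0" "p < -1"
  shows "(\<integral>\<^sup>+s. ennreal (s powr p) * indicator {a..} s \<partial>lborel) = ennreal (a powr (p + 1) / - (p + 1))"
proof -
  have "(\<integral>\<^sup>+s. ennreal (s powr p) * indicator {a..} s \<partial>lborel)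
      = ennreal (0 - a powr (p + 1) / (p + 1))"
  proof (rule nn_integral_FTC_atLeast)
    show "((\<lambda>s. s powr (p + 1) / (p + 1)) has_real_derivative s powr p) (at s)" if "a \<le> s" for s
      using that assms DERIV_cdivide[OF has_real_derivative_powr[of s "p + 1"], of "p + 1"] by simp
    have "((\<lambda>s::real. s powr (p + 1)) \<longlongrightarrow> 0) at_top"
      using assms by (intro tendsto_neg_powr filterlim_ident) auto
    then show "((\<lambda>s. s powr (p + 1) / (p + 1)) \<longlongrightarrow> 0) at_top"
      using tendsto_divide_zero by blast
  qed auto
  moreover have "0 - a powr (p + 1) / (p + 1) = a powr (p + 1) / - (p + 1)"
    by (simp only: divide_minus_right diff_0)
  ultimately show ?thesis by simp
qed

lemma tail_integral_powr:
  assumes "\<delta> > 0"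
  shows "(\<integral>\<^sup>+x\<in>- ball 0 1. ennreal (norm (x :: real^'n) powr (- real CARD('n) - \<delta>)) \<partial>lborel)
    = ennreal (real CARD('n) * unit_ball_vol (real CARD('n)) / \<delta>)"
proof -
  define N where "N = CARD('n)"
  define c where "c = real N * unit_ball_vol (real N)"
  have c: "c \<ge> 0" by (simp add: c_def)
  have N: "N > 0" by (simp add: N_def)
  have "(\<integral>\<^sup>+x\<in>- ball 0 1. ennreal (norm (x :: real^'n) powr (- real N - \<delta>)) \<partial>lborel)
      = (\<integral>\<^sup>+x. (\<lambda>s. ennreal (s powr (- real N - \<delta>)) * indicator {1..} s) (norm (x :: real^'n)) \<partial>lborel)"
    by (intro nn_integral_cong) (auto split: split_indicator)
  also have "\<dots> = (\<integral>\<^sup>+s. ennreal c * (ennreal (s powr (- 1 - \<delta>)) * indicator {1..} s) \<partial>lborel)"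
  proof (subst nn_integral_radial, simp, intro nn_integral_cong)
    fix s :: real
    have "s ^ (N - 1) * s powr (- real N - \<delta>) = s powr (- 1 - \<delta>)" if "s \<ge> 1"
      using that N by (simp add: powr_realpow[symmetric] of_nat_diff flip: powr_add)
    then have "c * s ^ (N - 1) * s powr (- real N - \<delta>) = c * s powr (- 1 - \<delta>)" if "s \<ge> 1"
      using that by (simp add: mult.assoc)
    then show "ennreal (real CARD('n) * unit_ball_vol (real CARD('n)) * s ^ (CARD('n) - 1)) * indicator {0..} s *
           (ennreal (s powr (- real N - \<delta>)) * indicator {1..} s) =
         ennreal c * (ennreal (s powr (- 1 - \<delta>)) * indicator {1..} s)"
      using c by (auto split: split_indicator simp: ennreal_mult[symmetric] N_def[symmetric] c_def[symmetric])
  qed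
  also have "\<dots> = ennreal c * ennreal (1 powr (-1 - \<delta> + 1) / - (-1 - \<delta> + 1))"
    using assms by (subst nn_integral_cmult) (auto simp: power_integral_Ici)
  also have "\<dots> = ennreal (c / \<delta>)" using c assms by (simp add: ennreal_mult[symmetric])
  finally show ?thesis by (simp add: N_def c_def)
qed

section \<open>Smooth functions and bumps supported in boxes\<close>

lemma Ck_SucI:
  assumes "\<And>x. (\<phi> has_derivative D x) (at x)" "\<And>v. Ck k (\<lambda>x. D x v)"
  shows "Ck (Suc k) \<phi>"
proof -
  have "frechet_derivative \<phi> (at x) = D x" for x
    using frechet_derivative_at[OF assms(1)] by simp
  then show ?thesis using assms by (auto simp: differentiable_def)
qed

lemma Ck_Suc_has_derivative:
  assumes "Ck (Suc k) \<phi>"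
  shows "(\<phi> has_derivative frechet_derivative \<phi> (at x)) (at x)"
  using assms frechet_derivative_works by auto

lemma Ck_Suc_line_derivative:
  fixes \<phi> :: "real^'n \<Rightarrow> real"
  assumes "Ck (Suc k) \<phi>"
  shows "((\<lambda>t. \<phi> (x + t *\<^sub>R v)) has_real_derivative
    frechet_derivative \<phi> (at (x + t *\<^sub>R v)) v) (at t)"
proof -
  let ?D = "frechet_derivative \<phi> (at (x + t *\<^sub>R v))"
  have "((\<lambda>t. \<phi> (x + t *\<^sub>R v)) has_derivative (\<lambda>s. ?D (s *\<^sub>R v))) (at t)"
    by (rule has_derivative_compose[where f = "\<lambda>t. x + t *\<^sub>R v"])
       (auto intro!: derivative_eq_intros Ck_Suc_has_derivative[OF assms])
  moreover have "?D (s *\<^sub>R v) = ?D v * s" for s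
    using linear_scale[OF has_derivative_linear[OF Ck_Suc_has_derivative[OF assms]]]
    by (simp add: mult.commute)
  ultimately show ?thesis by (simp add: has_field_derivative_def)
qed

text \<open>For \<open>k = 0\<close> this is the continuity of a differentiable function; the induction passes to the
directional derivatives.\<close>

lemma Ck_SucD: "Ck (Suc k) \<phi> \<Longrightarrow> Ck k \<phi>"
proof (induction k arbitrary: \<phi>)
  case 0
  then show ?case
    by (auto intro!: differentiable_imp_continuous_on simp: differentiable_on_def
        differentiable_at_withinI)
next
  case (Suc k)
  then show ?case by auto
qed

lemma Ck_const: "Ck k (\<lambda>x. c)"
proof (induction k arbitrary: c)
  case (Suc k)
  show ?case by (rule Ck_SucI[where D = "\<lambda>x v. 0"]) (use Suc in auto)
qed auto

lemma Ck_add: "Ck k \<phi> \<Longrightarrow> Ck k \<psi> \<Longrightarrow> Ck k (\<lambda>x. \<phi> x + \<psi> x)"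
proof (induction k arbitrary: \<phi> \<psi>)
  case (Suc k)
  show ?case
  proof (rule Ck_SucI)
    show "((\<lambda>x. \<phi> x + \<psi> x) has_derivative
       (\<lambda>v. frechet_derivative \<phi> (at x) v + frechet_derivative \<psi> (at x) v)) (at x)" for x
      by (intro has_derivative_add Ck_Suc_has_derivative[OF Suc.prems(1)]
          Ck_Suc_has_derivative[OF Suc.prems(2)])
  qed (use Suc in auto)
qed (auto intro: continuous_intros)

lemma Ck_mult: "Ck k \<phi> \<Longrightarrow> Ck k \<psi> \<Longrightarrow> Ck k (\<lambda>x. \<phi> x * \<psi> x)"
proof (induction k arbitrary: \<phi> \<psi>)
  case (Suc k)
  show ?case
  proof (rule Ck_SucI)
    show "((\<lambda>x. \<phi> x * \<psi> x) has_derivative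
       (\<lambda>v. \<phi> x * frechet_derivative \<psi> (at x) v + frechet_derivative \<phi> (at x) v * \<psi> x)) (at x)" for x
      by (intro has_derivative_mult Ck_Suc_has_derivative[OF Suc.prems(1)]
          Ck_Suc_has_derivative[OF Suc.prems(2)])
    show "Ck k (\<lambda>x. \<phi> x * frechet_derivative \<psi> (at x) v + frechet_derivative \<phi> (at x) v * \<psi> x)" for v
      using Suc.prems by (intro Ck_add Suc.IH Ck_SucD[of k \<phi>] Ck_SucD[of k \<psi>]) auto
  qed
qed (auto intro: continuous_intros)

lemma Ck_prod:
  "finite I \<Longrightarrow> (\<And>i. i \<in> I \<Longrightarrow> Ck k (\<phi> i)) \<Longrightarrow> Ck k (\<lambda>x. \<Prod>i\<in>I. \<phi> i x)"
  by (induction I rule: finite_induct) (auto intro: Ck_const Ck_mult)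

lemma Ck_affine_coordinate:
  fixes i :: "'n::finite"
  assumes "\<And>t. (h has_real_derivative h' t) (at t)"
    and "Ck k (\<lambda>x::real^'n. h' (s * x $ i + d))"
  shows "Ck (Suc k) (\<lambda>x::real^'n. h (s * x $ i + d))"
proof (rule Ck_SucI)
  show "((\<lambda>x::real^'n. h (s * x $ i + d)) has_derivative
      (\<lambda>v. h' (s * x $ i + d) * (s * v $ i))) (at x)" for x
    by (rule has_derivative_eq_rhs[OF has_derivative_compose[OF _
          assms(1)[unfolded has_field_derivative_def], of "\<lambda>x. s * x $ i + d"]])
       (auto intro!: derivative_eq_intros bounded_linear.has_derivative[OF bounded_linear_vec_nth])
qed (intro Ck_mult Ck_const assms)

lemma Cc_inftyI:
  fixes \<phi> :: "real^'n \<Rightarrow> real"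
  assumes "\<And>k. Ck k \<phi>" "\<And>x j. \<phi> x \<noteq> 0 \<Longrightarrow> \<bar>x $ j\<bar> \<le> M j"
  shows "\<phi> \<in> Cc_infty"
proof -
  have "{x. \<phi> x \<noteq> 0} \<subseteq> cbox (\<chi> j. - M j) (\<chi> j. M j)"
  proof
    fix x assume "x \<in> {x. \<phi> x \<noteq> 0}"
    then have "\<bar>x $ j\<bar> \<le> M j" for j using assms(2) by blast
    then show "x \<in> cbox (\<chi> j. - M j) (\<chi> j. M j)"
      by (simp add: mem_box_cart abs_le_iff minus_le_iff)
  qed
  then have "bounded {x. \<phi> x \<noteq> 0}" using bounded_cbox bounded_subset by blast
  then show ?thesis using assms(1) by (simp add: Cc_infty_def compact_closure)
qed

text \<open>For \<open>p = 1\<close> this is the classical smooth function that is flat at \<open>0\<close>.  The factor \<open>poly p (1 / t)\<close>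
makes the family closed under differentiation; the parameter \<open>c\<close> lets \<open>flat c 1\<close> tend to the
indicator of the positive half-line as \<open>c\<close> tends to \<open>0\<close>.\<close>

definition flat :: "real \<Rightarrow> real poly \<Rightarrow> real \<Rightarrow> real" where
  "flat c p t = (if t \<le> 0 then 0 else poly p (1 / t) * exp (- c / t))"

text \<open>In the variable \<open>y = 1 / t\<close> this is the statement that the functions \<open>flat c p\<close>, divided by any power
of \<open>t\<close>, vanish at \<open>0\<close>.\<close>

lemma poly_times_exp_tendsto_0:
  fixes p :: "real poly"
  assumes "c > 0"
  shows "((\<lambda>y. poly p y * exp (- c * y)) \<longlongrightarrow> 0) at_top"
proof -
  have mono: "((\<lambda>y. y ^ k * exp (- c * y)) \<longlongrightarrow> 0) at_top" for k
  proof -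
    have lim: "filterlim (\<lambda>y. c * y) at_top at_top"
      by (rule filterlim_tendsto_pos_mult_at_top[OF tendsto_const assms filterlim_ident])
    have "((\<lambda>y. (c * y) ^ k / exp (c * y) / c ^ k) \<longlongrightarrow> 0) at_top"
      by (intro tendsto_divide_zero filterlim_compose[OF tendsto_power_div_exp_0 lim])
    moreover have "(c * y) ^ k / exp (c * y) / c ^ k = y ^ k * exp (- c * y)" for y
      using assms by (simp add: power_mult_distrib exp_minus field_simps)
    ultimately show ?thesis by simp
  qed
  have "((\<lambda>y. \<Sum>k\<le>degree p. coeff p k * (y ^ k * exp (- c * y))) \<longlongrightarrow> 0) at_top"
    by (intro tendsto_null_sum tendsto_mult_right_zero mono)
  then show ?thesis by (simp add: poly_altdef sum_distrib_right mult.assoc)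
qed

text \<open>With \<open>s = 1 / t\<close> one has \<open>ds/dt = - s\<^sup>2\<close>, so the derivative of \<open>p s * exp (- c * s)\<close> is
\<open>- s\<^sup>2 * (p' s - c * p s) * exp (- c * s)\<close>.  At \<open>0\<close> the difference quotient is of the same kind with an
additional factor \<open>s\<close>.\<close>

lemma flat_has_derivative:
  assumes "c > 0"
  shows "(flat c p has_real_derivative flat c ([:0, 0, -1:] * (pderiv p - smult c p)) t) (at t)"
proof -
  consider "t < 0" | "t > 0" | "t = 0" by linarith
  then show ?thesis
  proof cases
    case 1
    have "((\<lambda>_. 0) has_real_derivative 0) (at t)" by simp
    then have "(flat c p has_real_derivative 0) (at t)"
      by (rule has_field_derivative_transform_within_open[where S = "{..<0}"])
         (use 1 in \<open>auto simp: flat_def\<close>)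
    then show ?thesis using 1 by (simp add: flat_def)
  next
    case 2
    have "((\<lambda>t. poly p (1 / t) * exp (- c / t)) has_real_derivative
        poly ([:0, 0, -1:] * (pderiv p - smult c p)) (1 / t) * exp (- c / t)) (at t)"
      using 2 by (auto intro!: derivative_eq_intros DERIV_chain2[OF poly_DERIV]
          simp: field_simps power2_eq_square)
    then have "(flat c p has_real_derivative
        poly ([:0, 0, -1:] * (pderiv p - smult c p)) (1 / t) * exp (- c / t)) (at t)"
      by (rule has_field_derivative_transform_within_open[where S = "{0<..}"])
         (use 2 in \<open>auto simp: flat_def\<close>)
    then show ?thesis using 2 by (simp add: flat_def)
  next
    case 3
    \<comment> \<open>\<open>pCons 0 p\<close> is \<open>p\<close> times the variable, which accounts for the division by \<open>h\<close>\<close>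
    have "((\<lambda>h. poly (pCons 0 p) (inverse h) * exp (- c * inverse h)) \<longlongrightarrow> 0) (at_right 0)"
      by (rule filterlim_compose[OF poly_times_exp_tendsto_0[OF assms] filterlim_inverse_at_top_right])
    then have "((\<lambda>h. (flat c p (0 + h) - flat c p 0) / h) \<longlongrightarrow> 0) (at_right 0)"
      by (rule Lim_transform_eventually)
         (auto simp: eventually_at_right_less flat_def field_simps
           intro!: eventually_mono[OF eventually_at_right_less[of 0]])
    moreover have "((\<lambda>h. (flat c p (0 + h) - flat c p 0) / h) \<longlongrightarrow> 0) (at_left 0)"
      by (rule Lim_transform_eventually[OF tendsto_const])
         (auto simp: flat_def eventually_at_filter)
    ultimately have "((\<lambda>h. (flat c p (0 + h) - flat c p 0) / h) \<longlongrightarrow> 0) (at 0)"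
      by (rule filterlim_split_at[rotated])
    then show ?thesis using 3 by (simp add: DERIV_def flat_def)
  qed
qed

lemma Ck_flat:
  assumes "c > 0"
  shows "Ck k (\<lambda>x::real^'n. flat c p (s * x $ i + d))"
proof (induction k arbitrary: p)
  case 0
  have "isCont (flat c p) t" for t
    using flat_has_derivative[OF assms] DERIV_isCont by blast
  then have "continuous_on UNIV (flat c p)" by (simp add: continuous_on_eq_continuous_at)
  then have "continuous_on UNIV (\<lambda>x::real^'n. flat c p (s * x $ i + d))"
    by (rule continuous_on_compose2) (auto intro!: continuous_intros)
  then show ?case by simp
next
  case (Suc k)
  show ?case by (rule Ck_affine_coordinate[OF flat_has_derivative[OF assms] Suc])
qed

definition bump :: "real \<Rightarrow> real \<Rightarrow> real \<Rightarrow> real \<Rightarrow> real" where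
  "bump c a b t = flat c 1 (t - a) * flat c 1 (b - t)"

lemma Ck_bump:
  assumes "c > 0" shows "Ck k (\<lambda>x::real^'n. bump c a b (x $ i + d))"
  unfolding bump_def
  using Ck_mult[OF Ck_flat[OF assms, of k 1 1 i "d - a"] Ck_flat[OF assms, of k 1 "-1" i "b - d"]]
  by (simp add: algebra_simps)

lemma bump_range: "c > 0 \<Longrightarrow> 0 \<le> bump c a b t" "c > 0 \<Longrightarrow> bump c a b t \<le> 1"
  by (auto simp: bump_def flat_def intro!: mult_le_one)

lemma bump_eq_0: "t \<le> a \<or> b \<le> t \<Longrightarrow> bump c a b t = 0"
  by (auto simp: bump_def flat_def)

lemma continuous_bump:
  assumes "c > 0" shows "isCont (bump c a b) t"
proof -
  have "isCont (flat c 1) t" for t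
    using flat_has_derivative[OF assms] DERIV_isCont by blast
  then have "isCont (\<lambda>t. flat c 1 (t - a)) t" "isCont (\<lambda>t. flat c 1 (b - t)) t"
    using isCont_o2[of t "\<lambda>t. t - a" "flat c 1"] isCont_o2[of t "\<lambda>t. b - t" "flat c 1"] by auto
  then show ?thesis unfolding bump_def[abs_def] by (rule isCont_mult)
qed

lemma bump_tendsto_indicator:
  "(\<lambda>m. bump (1 / real (Suc m)) a b t) \<longlonglongrightarrow> indicator {a<..<b} t"
proof (cases "t \<in> {a<..<b}")
  case True
  have "(\<lambda>m. exp (- (1 / real (Suc m)) / (t - a)) * exp (- (1 / real (Suc m)) / (b - t)))
      \<longlonglongrightarrow> exp (- 0 / (t - a)) * exp (- 0 / (b - t))"
    using True by (intro tendsto_intros LIMSEQ_Suc[OF lim_1_over_n]) auto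
  then show ?thesis using True by (simp add: bump_def flat_def)
next
  case False
  then have "bump c a b t = 0" for c by (intro bump_eq_0) auto
  then show ?thesis using False by simp
qed

definition box_bump :: "real \<Rightarrow> real^'n \<Rightarrow> real^'n \<Rightarrow> real^'n \<Rightarrow> real" where
  "box_bump c a b x = (\<Prod>j\<in>UNIV. bump c (a $ j) (b $ j) (x $ j))"

lemma box_bump_range:
  assumes "c > 0" shows "0 \<le> box_bump c a b x" "box_bump c a b x \<le> 1"
  using bump_range[OF assms] by (auto simp: box_bump_def intro: prod_nonneg prod_le_1)

lemma box_bump_eq_0: "x \<notin> box a b \<Longrightarrow> box_bump c a b x = 0"
  by (auto simp: box_bump_def mem_box_cart not_less intro!: bump_eq_0)

lemma box_bump_tendsto_indicator:
  "(\<lambda>m. box_bump (1 / real (Suc m)) a b x) \<longlonglongrightarrow> indicator (box a b) x"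
proof -
  have "(\<lambda>m. box_bump (1 / real (Suc m)) a b x)
      \<longlonglongrightarrow> (\<Prod>j\<in>UNIV. indicator {a $ j<..<b $ j} (x $ j))"
    unfolding box_bump_def by (intro tendsto_prod bump_tendsto_indicator)
  also have "(\<Prod>j\<in>UNIV. indicator {a $ j<..<b $ j} (x $ j)) = (indicator (box a b) x :: real)"
    by (auto simp: indicator_def mem_box_cart)
  finally show ?thesis .
qed

lemma box_bump_Cc_infty:
  assumes "c > 0" shows "box_bump c a b \<in> Cc_infty"
proof (rule Cc_inftyI)
  show "Ck k (box_bump c a b)" for k
    unfolding box_bump_def[abs_def] using Ck_bump[OF assms, where d = 0] by (intro Ck_prod) auto
  fix x j assume "box_bump c a b x \<noteq> 0"
  then have "x \<in> box a b" using box_bump_eq_0 by blast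
  then show "\<bar>x $ j\<bar> \<le> max \<bar>a $ j\<bar> \<bar>b $ j\<bar>"
    by (auto simp: mem_box_cart dest!: spec[of _ j])
qed

text \<open>Translating along the \<open>i\<close>-th axis changes only the \<open>i\<close>-th factor \<open>B\<close> of the product.  If \<open>A\<close> is an
antiderivative of \<open>B\<close>, then \<open>A t - A (t - h)\<close> is an antiderivative of \<open>B t - B (t - h)\<close>, and it has
compact support because \<open>A\<close> is constant on both sides of the support of \<open>B\<close>.\<close>

lemma box_bump_minus_translate_eq_derivative:
  fixes a b :: "real^'n"
  assumes c: "c > 0"
  shows "\<exists>\<Psi>\<in>Cc_infty. \<forall>x. frechet_derivative \<Psi> (at x) (axis i 1) =
    box_bump c a b x - box_bump c a b (x - h *\<^sub>R axis i 1)"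
proof -
  define B where "B = bump c (a $ i) (b $ i)"
  have "\<exists>F. \<forall>x. - \<infinity> < ereal x \<longrightarrow> ereal x < \<infinity> \<longrightarrow> (F has_vector_derivative B x) (at x)"
    by (rule einterval_antiderivative) (auto simp: B_def continuous_bump[OF c])
  then obtain A where A: "(A has_real_derivative B t) (at t)" for t
    by (auto simp: has_real_derivative_iff_has_vector_derivative)
  have A_eq: "A s = A t" if st: "s \<le> t" and out: "t \<le> a $ i \<or> b $ i \<le> s" for s t
  proof (cases "s = t")
    case False
    then obtain z where z: "s < z" "z < t" "A t - A s = (t - s) * B z"
      using MVT2[of s t A B] A st by auto
    moreover have "B z = 0" unfolding B_def using z out by (intro bump_eq_0) auto
    ultimately show ?thesis by simp
  qed simp
  define \<Phi> where "\<Phi> t = A t - A (t - h)" for t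
  define P where "P x = (\<Prod>j\<in>UNIV - {i}. bump c (a $ j) (b $ j) (x $ j))" for x :: "real^'n"
  define \<Psi> where "\<Psi> x = \<Phi> (x $ i) * P x" for x
  have \<Phi>': "(\<Phi> has_real_derivative B t - B (t - h)) (at t)" for t
    unfolding \<Phi>_def by (auto intro!: derivative_eq_intros A DERIV_chain2[OF A])
  \<comment> \<open>\<open>A\<close> itself is not made of flat functions, but the derivative of \<open>\<Phi>\<close> is\<close>
  have \<Phi>_Suc: "Ck (Suc k) (\<lambda>x::real^'n. \<Phi> (x $ i))" for k
  proof -
    have "Ck k (\<lambda>x::real^'n. B (x $ i + 0) + (- 1) * B (x $ i + (- h)))"
      unfolding B_def by (intro Ck_add Ck_mult Ck_const Ck_bump c)
    then have "Ck (Suc k) (\<lambda>x::real^'n. \<Phi> (1 * x $ i + 0))"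
      by (intro Ck_affine_coordinate[OF \<Phi>']) simp
    then show ?thesis by simp
  qed
  have P: "Ck k P" for k
    unfolding P_def[abs_def] using Ck_bump[OF c, where d = 0] by (intro Ck_prod) auto
  have \<Psi>: "Ck k \<Psi>" for k
    unfolding \<Psi>_def by (intro Ck_mult P Ck_SucD[OF \<Phi>_Suc])
  have "\<Psi> \<in> Cc_infty"
  proof (rule Cc_inftyI[OF \<Psi>])
    fix x j assume nz: "\<Psi> x \<noteq> 0"
    show "\<bar>x $ j\<bar> \<le> \<bar>a $ j\<bar> + \<bar>b $ j\<bar> + \<bar>h\<bar>"
    proof (cases "j = i")
      case True
      have "A (x $ i) \<noteq> A (x $ i - h)" using nz by (auto simp: \<Psi>_def \<Phi>_def)
      then have "\<not> (max (x $ i) (x $ i - h) \<le> a $ i \<or> b $ i \<le> min (x $ i) (x $ i - h))"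
        using A_eq[of "min (x $ i) (x $ i - h)" "max (x $ i) (x $ i - h)"]
        by (auto simp: min_def max_def split: if_splits)
      then show ?thesis using True by (auto simp: abs_real_def max_def min_def split: if_splits)
    next
      case False
      have "bump c (a $ j) (b $ j) (x $ j) \<noteq> 0" using nz False by (auto simp: \<Psi>_def P_def)
      then have "a $ j < x $ j" "x $ j < b $ j" using bump_eq_0 by (meson not_less)+
      then show ?thesis by linarith
    qed
  qed
  moreover have "frechet_derivative \<Psi> (at x) (axis i 1) =
    box_bump c a b x - box_bump c a b (x - h *\<^sub>R axis i 1)" for x
  proof -
    have "((\<lambda>t. \<Psi> (x + t *\<^sub>R axis i 1)) has_real_derivative
        frechet_derivative \<Psi> (at x) (axis i 1)) (at 0)"
      using Ck_Suc_line_derivative[OF \<Psi>[of "Suc 0"], of x "axis i 1" 0] by simp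
    moreover have "((\<lambda>t. \<Psi> (x + t *\<^sub>R axis i 1)) has_real_derivative
        (B (x $ i) - B (x $ i - h)) * P x) (at 0)"
    proof -
      have "P (x + t *\<^sub>R axis i 1) = P x" for t
        by (auto simp: P_def axis_def intro!: prod.cong)
      then have "(\<lambda>t. \<Psi> (x + t *\<^sub>R axis i 1)) = (\<lambda>t. \<Phi> (x $ i + t) * P x)"
        by (simp add: \<Psi>_def axis_def)
      moreover have "((\<lambda>t. \<Phi> (x $ i + t) * P x) has_real_derivative
        (B (x $ i) - B (x $ i - h)) * P x) (at 0)"
        using DERIV_shift[of \<Phi> "B (x $ i) - B (x $ i - h)" 0 "x $ i"] \<Phi>'[of "x $ i"]
        by (intro DERIV_cmult_right) (simp only: add_0 add.commute[of "x $ i"])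
      ultimately show ?thesis by simp
    qed
    ultimately have "frechet_derivative \<Psi> (at x) (axis i 1) = (B (x $ i) - B (x $ i - h)) * P x"
      by (rule DERIV_unique)
    moreover have "box_bump c a b x = B (x $ i) * P x" for x
      by (simp add: box_bump_def P_def B_def prod.remove[of UNIV i])
    moreover have "P (x - h *\<^sub>R axis i 1) = P x"
      by (auto simp: P_def axis_def intro!: prod.cong)
    ultimately show ?thesis by (simp add: axis_def algebra_simps)
  qed
  ultimately show ?thesis by blast
qed

section \<open>Test functions and weak gradients\<close>

lemma Cc_infty_has_derivative:
  "\<phi> \<in> Cc_infty \<Longrightarrow> (\<phi> has_derivative frechet_derivative \<phi> (at x)) (at x)"
  by (rule Ck_Suc_has_derivative[of 0]) (simp add: Cc_infty_def)

lemma Cc_infty_line_derivative: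
  "\<phi> \<in> Cc_infty \<Longrightarrow> ((\<lambda>t. \<phi> (x + t *\<^sub>R v)) has_real_derivative
    frechet_derivative \<phi> (at (x + t *\<^sub>R v)) v) (at t)"
  by (rule Ck_Suc_line_derivative[of 0]) (simp add: Cc_infty_def)

lemma Cc_infty_continuous_on: "\<phi> \<in> Cc_infty \<Longrightarrow> continuous_on S \<phi>"
proof -
  assume "\<phi> \<in> Cc_infty"
  then have "Ck 0 \<phi>" unfolding Cc_infty_def by blast
  then have "continuous_on UNIV \<phi>" by simp
  then show "continuous_on S \<phi>" by (rule continuous_on_subset) simp
qed

lemma Cc_infty_measurable: "\<phi> \<in> Cc_infty \<Longrightarrow> \<phi> \<in> borel_measurable borel"
  by (intro borel_measurable_continuous_onI Cc_infty_continuous_on)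

lemma Cc_infty_bounded_support:
  assumes "\<phi> \<in> Cc_infty"
  obtains M R where "M \<ge> 0" "R > 0" "\<And>x. \<bar>\<phi> x\<bar> \<le> M" "\<And>x. norm x \<ge> R \<Longrightarrow> \<phi> x = 0"
proof -
  have K: "compact (closure {x. \<phi> x \<noteq> 0})" using assms by (simp add: Cc_infty_def)
  then have "bounded (closure {x. \<phi> x \<noteq> 0})" by (rule compact_imp_bounded)
  then obtain R where R: "R > 0" "\<And>x. x \<in> closure {x. \<phi> x \<noteq> 0} \<Longrightarrow> norm x < R"
    unfolding bounded_pos_less by auto
  have "compact (\<phi> ` closure {x. \<phi> x \<noteq> 0})"
    by (intro compact_continuous_image Cc_infty_continuous_on assms K)
  then have "bounded (\<phi> ` closure {x. \<phi> x \<noteq> 0})" by (rule compact_imp_bounded)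
  then obtain M where M: "M > 0" "\<And>x. x \<in> closure {x. \<phi> x \<noteq> 0} \<Longrightarrow> \<bar>\<phi> x\<bar> \<le> M"
    unfolding bounded_pos by auto
  have cl: "\<phi> x \<noteq> 0 \<Longrightarrow> x \<in> closure {x. \<phi> x \<noteq> 0}" for x
    using closure_subset[of "{x. \<phi> x \<noteq> 0}"] by auto
  show ?thesis
  proof (rule that)
    show "M \<ge> 0" "R > 0" using M R by auto
    show "\<bar>\<phi> x\<bar> \<le> M" for x using M cl[of x] by (cases "\<phi> x = 0") auto
    show "\<phi> x = 0" if "norm x \<ge> R" for x
      using R(2)[OF cl] that by (meson not_less)
  qed
qed

lemma Cc_infty_derivative:
  assumes "\<phi> \<in> Cc_infty"
  shows "(\<lambda>x. frechet_derivative \<phi> (at x) v) \<in> Cc_infty"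
proof -
  obtain M R where R: "\<And>x. norm x \<ge> R \<Longrightarrow> \<phi> x = 0"
    using Cc_infty_bounded_support[OF assms] by metis
  show ?thesis
  proof (rule Cc_inftyI)
    show "Ck k (\<lambda>x. frechet_derivative \<phi> (at x) v)" for k
      using assms unfolding Cc_infty_def by (auto dest!: spec[of _ "Suc k"])
    fix x j assume nz: "frechet_derivative \<phi> (at x) v \<noteq> 0"
    have "norm x \<le> R"
    proof (rule ccontr)
      assume "\<not> norm x \<le> R"
      then have x: "x \<in> - cball 0 R" by simp
      have "((\<lambda>_. 0) has_derivative (\<lambda>_. 0)) (at x)" by simp
      then have "(\<phi> has_derivative (\<lambda>_. 0)) (at x)"
        by (rule has_derivative_transform_within_open[where s = "- cball 0 R"]) (use x R in auto)
      then show False using nz frechet_derivative_at[of \<phi> "\<lambda>_. 0" x] by metis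
    qed
    then show "\<bar>x $ j\<bar> \<le> R" using component_le_norm_cart[of x j] by linarith
  qed
qed

lemma Cc_infty_mult:
  assumes "\<phi> \<in> Cc_infty" "\<psi> \<in> Cc_infty"
  shows "(\<lambda>x. \<phi> x * \<psi> x) \<in> Cc_infty"
proof -
  obtain M R where R: "\<And>x. norm x \<ge> R \<Longrightarrow> \<phi> x = 0"
    using Cc_infty_bounded_support[OF assms(1)] by metis
  show ?thesis
  proof (rule Cc_inftyI)
    show "Ck k (\<lambda>x. \<phi> x * \<psi> x)" for k
      using assms by (intro Ck_mult) (auto simp: Cc_infty_def)
    fix x j assume "\<phi> x * \<psi> x \<noteq> 0"
    then have "norm x \<le> R" using R[of x] by (cases "norm x \<ge> R") auto
    then show "\<bar>x $ j\<bar> \<le> R" using component_le_norm_cart[of x j] by linarith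
  qed
qed

lemma locally_integrable_mult_Cc_infty:
  fixes g :: "real^'n \<Rightarrow> real"
  assumes "locally_integrable g" "\<phi> \<in> Cc_infty"
  shows "integrable lborel (\<lambda>x. g x * \<phi> x)"
proof -
  obtain M R where M: "\<And>x. \<bar>\<phi> x\<bar> \<le> M" and R: "\<And>x. norm x \<ge> R \<Longrightarrow> \<phi> x = 0"
    using Cc_infty_bounded_support[OF assms(2)] by metis
  have [measurable]: "g \<in> borel_measurable lborel" "\<phi> \<in> borel_measurable lborel"
    using assms Cc_infty_measurable by (auto simp: locally_integrable_def)
  have "integrable lborel (\<lambda>x. M * \<bar>indicator (cball 0 R) x *\<^sub>R g x\<bar>)"
    using assms(1) unfolding locally_integrable_def set_integrable_def by auto
  then show ?thesis
  proof (rule Bochner_Integration.integrable_bound)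
    show "AE x in lborel. norm (g x * \<phi> x) \<le> norm (M * \<bar>indicator (cball 0 R) x *\<^sub>R g x\<bar>)"
      using R M order_trans[OF abs_ge_zero M]
      by (intro AE_I2) (auto simp: abs_mult mult.commute[of M] intro!: mult_left_mono split: split_indicator)
  qed measurable
qed

lemma continuous_imp_locally_integrable:
  assumes "continuous_on UNIV f" shows "locally_integrable f"
  unfolding locally_integrable_def set_integrable_def
proof (intro conjI allI impI)
  show "f \<in> borel_measurable lborel"
    using borel_measurable_continuous_onI[OF assms] by simp
  show "integrable lborel (\<lambda>x. indicator S x *\<^sub>R f x)" if "compact S" for S
    using that continuous_on_subset[OF assms] by (intro borel_integrable_compact) auto
qed

lemma locally_integrable_Cc_infty:
  fixes \<phi> :: "real^'n \<Rightarrow> real"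
  assumes "\<phi> \<in> Cc_infty" shows "locally_integrable \<phi>"
  by (intro continuous_imp_locally_integrable Cc_infty_continuous_on assms)

lemma Cc_infty_integrable:
  fixes \<phi> :: "real^'n \<Rightarrow> real"
  assumes "\<phi> \<in> Cc_infty" shows "integrable lborel \<phi>"
proof -
  have "locally_integrable (\<lambda>x::real^'n. 1::real)"
    by (intro continuous_imp_locally_integrable continuous_on_const)
  from locally_integrable_mult_Cc_infty[OF this assms] show ?thesis by simp
qed

lemma integral_translate:
  fixes f :: "real^'n \<Rightarrow> real"
  assumes [measurable]: "f \<in> borel_measurable borel"
  shows "(\<integral>x. f (x + v) \<partial>lborel) = (\<integral>x. f x \<partial>lborel)"
proof -
  have "(\<integral>x. f x \<partial>lborel) = (\<integral>x. f x \<partial>distr lborel borel ((+) v))"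
    by (simp add: lborel_distr_plus)
  also have "\<dots> = (\<integral>x. f (v + x) \<partial>lborel)" by (rule integral_distr) measurable
  finally show ?thesis by (simp add: add.commute)
qed

text \<open>The difference quotients of \<open>\<phi>\<close> in direction \<open>v\<close> have integral \<open>0\<close> by translation invariance, and they
converge boundedly, with supports in a fixed ball, to the directional derivative.\<close>

lemma integral_Cc_infty_derivative_eq_0:
  fixes \<phi> :: "real^'n \<Rightarrow> real"
  assumes \<phi>: "\<phi> \<in> Cc_infty"
  shows "(\<integral>x. frechet_derivative \<phi> (at x) v \<partial>lborel) = 0"
proof -
  obtain M where M: "M \<ge> 0" "\<And>x. \<bar>frechet_derivative \<phi> (at x) v\<bar> \<le> M"
    using Cc_infty_bounded_support[OF Cc_infty_derivative[OF \<phi>]] by metis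
  obtain R where R: "\<And>x. norm x \<ge> R \<Longrightarrow> \<phi> x = 0"
    using Cc_infty_bounded_support[OF \<phi>] by metis
  have [measurable]: "\<phi> \<in> borel_measurable borel"
      "(\<lambda>x. frechet_derivative \<phi> (at x) v) \<in> borel_measurable borel"
    using Cc_infty_measurable \<phi> Cc_infty_derivative by auto
  define q where "q n x = real (Suc n) * (\<phi> (x + (1 / real (Suc n)) *\<^sub>R v) - \<phi> x)" for n x
  note line = Cc_infty_line_derivative[OF \<phi>, where v = v]
  have bound: "\<bar>q n x\<bar> \<le> M * indicator (cball 0 (R + norm v)) x" for n x
  proof -
    define t where "t = 1 / real (Suc n)"
    have t: "0 < t" "t \<le> 1" "real (Suc n) * t = 1" by (auto simp: t_def)
    obtain z where z: "\<phi> (x + t *\<^sub>R v) - \<phi> x = t * frechet_derivative \<phi> (at (x + z *\<^sub>R v)) v"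
      using MVT2[OF t(1) line[of x]] by auto
    then have "q n x = frechet_derivative \<phi> (at (x + z *\<^sub>R v)) v"
      unfolding q_def t_def[symmetric] z mult.assoc[symmetric] t(3) by simp
    then have le: "\<bar>q n x\<bar> \<le> M" using M by simp
    have "q n x = 0" if "norm x > R + norm v"
    proof -
      have "norm (t *\<^sub>R v) \<le> norm v" using t by (simp add: mult_left_le_one_le)
      then have "norm (x + t *\<^sub>R v) \<ge> R"
        using that norm_triangle_ineq4[of "x + t *\<^sub>R v" "t *\<^sub>R v"] by simp
      moreover have "norm x \<ge> R" using that norm_ge_zero[of v] by linarith
      ultimately show ?thesis by (simp add: q_def R flip: t_def del: of_nat_Suc)
    qed
    then show ?thesis using le M(1) by (auto split: split_indicator)
  qed
  have "(\<lambda>n. \<integral>x. q n x \<partial>lborel) \<longlonglongrightarrow> (\<integral>x. frechet_derivative \<phi> (at x) v \<partial>lborel)"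
  proof (rule integral_dominated_convergence[where w = "\<lambda>x. M * indicator (cball 0 (R + norm v)) x"])
    have "emeasure lborel (cball (0::real^'n) (R + norm v)) < \<infinity>"
      using emeasure_bounded_finite bounded_cball by blast
    then show "integrable lborel (\<lambda>x::real^'n. M * indicator (cball 0 (R + norm v)) x)"
      by (intro integrable_mult_right integrable_real_indicator) auto
    show "AE x in lborel. (\<lambda>n. q n x) \<longlonglongrightarrow> frechet_derivative \<phi> (at x) v"
    proof (rule AE_I2)
      fix x
      have "(\<lambda>h. (\<phi> (x + (0 + h) *\<^sub>R v) - \<phi> (x + 0 *\<^sub>R v)) / h) \<midarrow>0\<rightarrow> frechet_derivative \<phi> (at x) v"
        using line[of x 0] by (simp add: DERIV_def)
      moreover have "filterlim (\<lambda>n. 1 / real (Suc n)) (at 0) sequentially"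
        using LIMSEQ_Suc[OF lim_1_over_n] by (auto simp: filterlim_at)
      ultimately have "(\<lambda>n. (\<phi> (x + (0 + 1 / real (Suc n)) *\<^sub>R v) - \<phi> (x + 0 *\<^sub>R v)) / (1 / real (Suc n)))
          \<longlonglongrightarrow> frechet_derivative \<phi> (at x) v"
        by (rule filterlim_compose)
      then show "(\<lambda>n. q n x) \<longlonglongrightarrow> frechet_derivative \<phi> (at x) v"
        by (simp add: q_def mult.commute)
    qed
    show "AE x in lborel. norm (q n x) \<le> M * indicator (cball 0 (R + norm v)) x" for n
      using bound by simp
    show "q n \<in> borel_measurable lborel" for n unfolding q_def by measurable
  qed measurable
  moreover have "(\<integral>x. q n x \<partial>lborel) = 0" for n
  proof -
    have i: "integrable lborel \<phi>" by (rule Cc_infty_integrable[OF \<phi>])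
    have "integrable lborel (\<lambda>x. \<phi> (x + w))" for w
    proof -
      have "integrable (distr lborel borel ((+) w)) \<phi>" using i by (simp add: lborel_distr_plus)
      then show ?thesis by (subst (asm) integrable_distr_eq) (auto simp: add.commute)
    qed
    then show ?thesis using i by (simp add: q_def integral_translate)
  qed
  ultimately show ?thesis by (simp add: LIMSEQ_const_iff)
qed

lemma frechet_derivative_mult_Cc_infty:
  assumes "\<phi> \<in> Cc_infty" "\<psi> \<in> Cc_infty"
  shows "frechet_derivative (\<lambda>x. \<phi> x * \<psi> x) (at x) v =
    \<phi> x * frechet_derivative \<psi> (at x) v + frechet_derivative \<phi> (at x) v * \<psi> x"
  using frechet_derivative_at[OF has_derivative_mult[OF Cc_infty_has_derivative[OF assms(1)]
      Cc_infty_has_derivative[OF assms(2)]], of x] by metis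

definition gradient :: "(real^'n \<Rightarrow> real) \<Rightarrow> real^'n \<Rightarrow> real^'n" where
  "gradient \<phi> x = (\<chi> i. frechet_derivative \<phi> (at x) (axis i 1))"

lemma gradient_continuous_on:
  assumes "\<phi> \<in> Cc_infty" shows "continuous_on S (gradient \<phi>)"
  unfolding gradient_def[abs_def]
  by (intro continuous_on_vec_lambda Cc_infty_continuous_on Cc_infty_derivative assms)

text \<open>Integration by parts: the derivative of the test function \<open>\<phi> * \<psi>\<close> has integral \<open>0\<close>.\<close>

lemma has_weak_gradient_Cc_infty:
  fixes \<phi> :: "real^'n \<Rightarrow> real"
  assumes \<phi>: "\<phi> \<in> Cc_infty"
  shows "has_weak_gradient \<phi> (gradient \<phi>)"
  unfolding has_weak_gradient_def
proof (intro conjI ballI allI)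
  show "locally_integrable \<phi>" by (rule locally_integrable_Cc_infty[OF \<phi>])
  show "locally_integrable (gradient \<phi>)"
    by (intro continuous_imp_locally_integrable gradient_continuous_on \<phi>)
  fix \<psi> :: "real^'n \<Rightarrow> real" and i assume \<psi>: "\<psi> \<in> Cc_infty"
  have "0 = (\<integral>x. frechet_derivative (\<lambda>x. \<phi> x * \<psi> x) (at x) (axis i 1) \<partial>lborel)"
    using integral_Cc_infty_derivative_eq_0[OF Cc_infty_mult[OF \<phi> \<psi>]] by simp
  also have "\<dots> = (\<integral>x. \<phi> x * frechet_derivative \<psi> (at x) (axis i 1) \<partial>lborel)
      + (\<integral>x. frechet_derivative \<phi> (at x) (axis i 1) * \<psi> x \<partial>lborel)"
    unfolding frechet_derivative_mult_Cc_infty[OF \<phi> \<psi>]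
    by (intro Bochner_Integration.integral_add locally_integrable_mult_Cc_infty
        locally_integrable_Cc_infty Cc_infty_derivative \<phi> \<psi>)
  finally show "(\<integral>x. \<phi> x * frechet_derivative \<psi> (at x) (axis i 1) \<partial>lborel)
     = - (\<integral>x. gradient \<phi> x $ i * \<psi> x \<partial>lborel)" by (simp add: gradient_def)
qed

lemma locally_integrable_diff:
  assumes "locally_integrable u" "locally_integrable v"
  shows "locally_integrable (\<lambda>x. u x - v x)"
  using assms unfolding locally_integrable_def
  by (auto intro!: set_integral_diff)

lemma locally_integrable_component:
  fixes G :: "real^'n \<Rightarrow> real^'m"
  assumes "locally_integrable G"
  shows "locally_integrable (\<lambda>x. G x $ i)"
  unfolding locally_integrable_def set_integrable_def
proof (intro conjI allI impI)
  have [measurable]: "G \<in> borel_measurable lborel" using assms by (simp add: locally_integrable_def)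
  show "(\<lambda>x. G x $ i) \<in> borel_measurable lborel"
    by (rule borel_measurable_continuous_on[of "\<lambda>v. v $ i"]) (auto intro!: continuous_intros)
  fix S :: "(real^'n) set" assume "compact S"
  then have "integrable lborel (\<lambda>x. indicator S x *\<^sub>R G x)"
    using assms by (simp add: locally_integrable_def set_integrable_def)
  from integrable_bounded_linear[OF bounded_linear_vec_nth this]
  show "integrable lborel (\<lambda>x. indicator S x *\<^sub>R G x $ i)" by simp
qed

lemma has_weak_gradient_diff:
  fixes u v :: "real^'n \<Rightarrow> real"
  assumes "has_weak_gradient u G" "has_weak_gradient v H"
  shows "has_weak_gradient (\<lambda>x. u x - v x) (\<lambda>x. G x - H x)"
  unfolding has_weak_gradient_def
proof (intro conjI ballI allI)
  show "locally_integrable (\<lambda>x. u x - v x)" "locally_integrable (\<lambda>x. G x - H x)"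
    using assms by (auto simp: has_weak_gradient_def intro: locally_integrable_diff)
  fix \<phi> :: "real^'n \<Rightarrow> real" and i assume \<phi>: "\<phi> \<in> Cc_infty"
  have "integrable lborel (\<lambda>x. u x * frechet_derivative \<phi> (at x) (axis i 1))"
       "integrable lborel (\<lambda>x. v x * frechet_derivative \<phi> (at x) (axis i 1))"
       "integrable lborel (\<lambda>x. G x $ i * \<phi> x)" "integrable lborel (\<lambda>x. H x $ i * \<phi> x)"
    using assms \<phi> by (auto simp: has_weak_gradient_def
        intro!: locally_integrable_mult_Cc_infty Cc_infty_derivative locally_integrable_component)
  then show "(\<integral>x. (u x - v x) * frechet_derivative \<phi> (at x) (axis i 1) \<partial>lborel)
     = - (\<integral>x. (G x - H x) $ i * \<phi> x \<partial>lborel)"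
    using assms \<phi> by (simp add: has_weak_gradient_def left_diff_distrib)
qed

text \<open>Test functions are enough to recover integrals over boxes.\<close>

lemma integral_box_bump_tendsto:
  fixes g :: "real^'n \<Rightarrow> real"
  assumes g: "locally_integrable g"
  shows "(\<lambda>m. \<integral>x. g x * box_bump (1 / real (Suc m)) a b x \<partial>lborel)
    \<longlonglongrightarrow> (\<integral>x. g x * indicator (box a b) x \<partial>lborel)"
proof (rule integral_dominated_convergence[where w = "\<lambda>x. \<bar>indicator (cbox a b) x *\<^sub>R g x\<bar>"])
  have [measurable]: "g \<in> borel_measurable lborel" using g by (simp add: locally_integrable_def)
  have [measurable]: "box_bump (1 / real (Suc m)) a b \<in> borel_measurable borel" for m
    by (intro Cc_infty_measurable box_bump_Cc_infty) simp
  show "integrable lborel (\<lambda>x. \<bar>indicator (cbox a b) x *\<^sub>R g x\<bar>)"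
    using g by (auto simp: locally_integrable_def set_integrable_def)
  show "AE x in lborel. (\<lambda>m. g x * box_bump (1 / real (Suc m)) a b x)
      \<longlonglongrightarrow> g x * indicator (box a b) x"
    by (intro AE_I2 tendsto_mult_left box_bump_tendsto_indicator)
  show "AE x in lborel. norm (g x * box_bump (1 / real (Suc m)) a b x)
      \<le> \<bar>indicator (cbox a b) x *\<^sub>R g x\<bar>" for m
  proof (rule AE_I2)
    fix x
    show "norm (g x * box_bump (1 / real (Suc m)) a b x) \<le> \<bar>indicator (cbox a b) x *\<^sub>R g x\<bar>"
    proof (cases "x \<in> box a b")
      case True
      then have "x \<in> cbox a b" using box_subset_cbox by blast
      then show ?thesis
        using box_bump_range[of "1 / real (Suc m)" a b x]
        by (simp add: abs_mult mult_left_le)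
    qed (simp add: box_bump_eq_0)
  qed
  show "(\<lambda>x. g x * box_bump (1 / real (Suc m)) a b x) \<in> borel_measurable lborel" for m
    by measurable
qed (use g in \<open>auto simp: locally_integrable_def\<close>)

text \<open>Lebesgue differentiation along the cubes with lower corner \<open>x\<close>.\<close>

lemma AE_abs_le_if_box_averages_le:
  fixes g W :: "real^'n \<Rightarrow> real"
  assumes g: "locally_integrable g"
    and avg: "\<And>x \<epsilon>. x \<in> S \<Longrightarrow> \<epsilon> > 0 \<Longrightarrow> \<exists>d>0. \<forall>h. 0 < h \<and> h < d \<longrightarrow>
      \<bar>\<integral>y. g y * indicator (box x (x + h *\<^sub>R One)) y \<partial>lborel\<bar> \<le> (W x + \<epsilon>) * h ^ CARD('n)"
  shows "AE x in lborel. x \<in> S \<longrightarrow> \<bar>g x\<bar> \<le> W x"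
proof -
  have si: "set_integrable lborel (cbox a b) g" for a b
    using g by (simp add: locally_integrable_def)
  have HK: "integral (cbox a b) g = (\<integral>y. g y * indicator (box a b) y \<partial>lborel)" for a b
  proof -
    have "integral (cbox a b) g = (\<integral>y. indicator (cbox a b) y *\<^sub>R g y \<partial>lborel)"
      using set_borel_integral_eq_integral(2)[OF si] by (simp add: set_lebesgue_integral_def)
    also have "\<dots> = (\<integral>y. g y * indicator (box a b) y \<partial>lborel)"
    proof (rule integral_cong_AE)
      have [measurable]: "g \<in> borel_measurable lborel" using g by (simp add: locally_integrable_def)
      show "(\<lambda>y. indicator (cbox a b) y *\<^sub>R g y) \<in> borel_measurable lborel"
        "(\<lambda>y. g y * indicator (box a b) y) \<in> borel_measurable lborel" by measurable
      have "cbox a b - box a b \<in> null_sets lborel"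
        using negligible_frontier_interval[of a b]
        by (simp add: negligible_iff_null_sets null_sets_completion_iff)
      from AE_not_in[OF this]
      show "AE y in lborel. indicator (cbox a b) y *\<^sub>R g y = g y * indicator (box a b) y"
      proof eventually_elim
        case (elim y)
        then show ?case
          using subsetD[OF box_subset_cbox[of a b], of y] by (auto simp: indicator_def)
      qed
    qed
    finally show ?thesis .
  qed
  have int: "g integrable_on cbox a b" for a b using set_borel_integral_eq_integral(1)[OF si] .
  obtain N where N: "negligible N" and diff: "\<And>x e. x \<notin> N \<Longrightarrow> 0 < e \<Longrightarrow>
      \<exists>d>0. \<forall>h. 0 < h \<and> h < d \<longrightarrow>
        norm (integral (cbox x (x + h *\<^sub>R One)) g /\<^sub>R h ^ DIM(real^'n) - g x) < e"
    by (rule integrable_ccontinuous_explicit[OF int]) (rule that)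
  have le: "\<bar>g x\<bar> \<le> W x" if xN: "x \<notin> N" and xS: "x \<in> S" for x
  proof (rule field_le_epsilon)
    fix e :: real assume "e > 0"
    then have e: "e / 2 > 0" by simp
    obtain d1 where d1: "d1 > 0" "\<And>h. 0 < h \<Longrightarrow> h < d1 \<Longrightarrow>
        norm (integral (cbox x (x + h *\<^sub>R One)) g /\<^sub>R h ^ DIM(real^'n) - g x) < e / 2"
      using diff[OF xN e] by auto
    obtain d2 where d2: "d2 > 0" "\<And>h. 0 < h \<Longrightarrow> h < d2 \<Longrightarrow>
        \<bar>\<integral>y. g y * indicator (box x (x + h *\<^sub>R One)) y \<partial>lborel\<bar> \<le> (W x + e / 2) * h ^ CARD('n)"
      using avg[OF xS e] by auto
    define h where "h = min d1 d2 / 2"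
    have h: "0 < h" "h < d1" "h < d2" using d1(1) d2(1) by (auto simp: h_def)
    define I where "I = integral (cbox x (x + h *\<^sub>R One)) g"
    have "\<bar>I / h ^ CARD('n) - g x\<bar> < e / 2"
      using d1(2)[OF h(1,2)] unfolding I_def[symmetric] real_scaleR_def inverse_eq_divide by simp
    moreover have "\<bar>I\<bar> \<le> (W x + e / 2) * h ^ CARD('n)" using d2(2)[OF h(1,3)] by (simp add: I_def HK)
    then have "\<bar>I / h ^ CARD('n)\<bar> \<le> W x + e / 2"
      using h(1) by (simp add: abs_divide pos_divide_le_eq)
    ultimately show "\<bar>g x\<bar> \<le> W x + e" by linarith
  qed
  have "AE x in lebesgue. x \<notin> N" using N by (simp add: negligible_iff_null_sets AE_not_in)
  then have "AE x in lborel. x \<notin> N"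
    by (simp add: AE_completion_iff)
  then show ?thesis by eventually_elim (simp add: le)
qed

text \<open>The fundamental lemma of the calculus of variations: testing with bumps shows that all box averages
of \<open>g\<close> vanish.\<close>

lemma AE_eq_0_if_orthogonal_Cc_infty:
  fixes g :: "real^'n \<Rightarrow> real"
  assumes g: "locally_integrable g"
    and orth: "\<And>\<phi>. \<phi> \<in> Cc_infty \<Longrightarrow> (\<integral>x. g x * \<phi> x \<partial>lborel) = 0"
  shows "AE x in lborel. g x = 0"
proof -
  have z: "(\<integral>x. g x * indicator (box a b) x \<partial>lborel) = 0" for a b
  proof -
    have "(\<integral>x. g x * box_bump (1 / real (Suc m)) a b x \<partial>lborel) = 0" for m
      by (intro orth box_bump_Cc_infty) simp
    then show ?thesis
      using integral_box_bump_tendsto[OF g, of a b] by (simp add: LIMSEQ_const_iff)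
  qed
  have "AE x in lborel. x \<in> UNIV \<longrightarrow> \<bar>g x\<bar> \<le> (\<lambda>_. 0) x"
    by (rule AE_abs_le_if_box_averages_le[OF g]) (auto simp: z intro!: exI[of _ 1])
  then show ?thesis by simp
qed

lemma weak_gradient_unique:
  fixes G H :: "real^'n \<Rightarrow> real^'n"
  assumes G: "has_weak_gradient u G" and H: "has_weak_gradient u H"
  shows "AE x in lborel. G x = H x"
proof -
  have "AE x in lborel. (G x - H x) $ i = 0" for i
  proof (rule AE_eq_0_if_orthogonal_Cc_infty)
    have GH: "has_weak_gradient (\<lambda>x. u x - u x) (\<lambda>x. G x - H x)"
      by (rule has_weak_gradient_diff[OF G H])
    then show "locally_integrable (\<lambda>x. (G x - H x) $ i)"
      by (intro locally_integrable_component) (simp add: has_weak_gradient_def)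
    show "(\<integral>x. (G x - H x) $ i * \<phi> x \<partial>lborel) = 0" if "\<phi> \<in> Cc_infty" for \<phi>
      using GH that by (auto simp: has_weak_gradient_def)
  qed
  then have "AE x in lborel. \<forall>i\<in>UNIV. (G x - H x) $ i = 0"
    by (intro AE_finite_allI) auto
  then show ?thesis by eventually_elim (simp add: vec_eq_iff)
qed

text \<open>The norm is defined from an arbitrarily chosen weak gradient; by uniqueness up to null sets every
weak gradient gives the same value.\<close>

lemma norm12_squared:
  fixes u :: "real^'n \<Rightarrow> real"
  assumes G: "has_weak_gradient u G"
  shows "(norm12 u)\<^sup>2 = (\<integral>x. (norm (G x))\<^sup>2 \<partial>lborel)"
proof -
  have w: "has_weak_gradient u (weak_gradient u)"
    unfolding weak_gradient_def by (rule someI[of "has_weak_gradient u", OF G])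
  have [measurable]: "G \<in> borel_measurable lborel" "weak_gradient u \<in> borel_measurable lborel"
    using G w by (auto simp: has_weak_gradient_def locally_integrable_def)
  have "(\<integral>x. (norm (weak_gradient u x))\<^sup>2 \<partial>lborel) = (\<integral>x. (norm (G x))\<^sup>2 \<partial>lborel)"
  proof (rule integral_cong_AE)
    show "AE x in lborel. (norm (weak_gradient u x))\<^sup>2 = (norm (G x))\<^sup>2"
      using weak_gradient_unique[OF w G] by eventually_elim simp
  qed measurable
  then show ?thesis by (simp add: norm12_def)
qed

section \<open>Radial test functions and their approximation property\<close>

lemma frechet_derivative_eq_inner_gradient:
  fixes \<phi> :: "real^'n \<Rightarrow> real"
  assumes "\<phi> \<in> Cc_infty"
  shows "frechet_derivative \<phi> (at x) v = gradient \<phi> x \<bullet> v"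
proof -
  have lin: "linear (frechet_derivative \<phi> (at x))"
    using has_derivative_linear[OF Cc_infty_has_derivative[OF assms]] .
  have "frechet_derivative \<phi> (at x) v = frechet_derivative \<phi> (at x) (\<Sum>i\<in>UNIV. v $ i *\<^sub>R axis i 1)"
    using basis_expansion[of v] by (simp add: scalar_mult_eq_scaleR)
  also have "\<dots> = (\<Sum>i\<in>UNIV. v $ i * frechet_derivative \<phi> (at x) (axis i 1))"
    using lin by (simp add: linear_sum linear_scale)
  finally show ?thesis by (simp add: inner_vec_def gradient_def mult.commute)
qed

text \<open>Write \<open>\<phi> x = g \<bar>x\<bar>\<close>.  Then \<open>\<bar>g r\<bar>\<close> is at most the integral of \<open>\<bar>g'\<bar>\<close> over \<open>[r, \<infinity>)\<close>, and
\<open>\<bar>g' s\<bar> \<le> l / 2 * \<kappa> * s\<^sup>N\<^sup>-\<^sup>1 * (g' s)\<^sup>2 + s powr (1 - N) / (2 * l * \<kappa>)\<close> for every \<open>l > 0\<close>,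
where \<open>\<kappa>\<close> is the area of the unit sphere.  The first summand
integrates to at most \<open>l / 2 * A\<close>, because \<open>\<bar>g' \<bar>x\<bar>\<bar> \<le> \<bar>\<nabla>\<phi> x\<bar>\<close> and \<open>\<kappa> * s\<^sup>N\<^sup>-\<^sup>1\<close> is the density of
polar coordinates; the second one to a multiple of \<open>r powr (2 - N) / l\<close>.  The choice
\<open>l = r powr - ((N - 2) / 2)\<close> balances the powers of \<open>r\<close>.  The bound is not homogeneous in \<open>\<phi>\<close>, but a
constant that depends only on a bound \<open>A\<close> for the energy is all that the decay in the unit ball
requires.\<close>

lemma radial_pointwise_bound:
  fixes \<phi> :: "real^'n \<Rightarrow> real"
  assumes N: "CARD('n) \<ge> 3" and \<phi>: "\<phi> \<in> Cc_infty_r"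
    and A: "(\<integral>\<^sup>+x. ennreal ((norm (gradient \<phi> x))\<^sup>2) \<partial>lborel) \<le> ennreal A" "A \<ge> 0"
    and x: "x \<noteq> 0"
  shows "\<bar>\<phi> x\<bar> \<le> (A + 1 / (real CARD('n) * unit_ball_vol (real CARD('n)) * (real CARD('n) - 2))) / 2
    * norm x powr - ((real CARD('n) - 2) / 2)"
proof -
  \<comment> \<open>any unit vector serves to define the profile \<open>g\<close>\<close>
  define e :: "real^'n" where "e = axis undefined 1"
  define n where "n = real CARD('n)"
  define \<kappa> where "\<kappa> = n * unit_ball_vol n"
  define g where "g s = \<phi> (s *\<^sub>R e)" for s
  define g' where "g' s = frechet_derivative \<phi> (at (s *\<^sub>R e)) e" for s
  have C: "\<phi> \<in> Cc_infty" and rad: "\<And>x y. norm x = norm y \<Longrightarrow> \<phi> x = \<phi> y"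
    using \<phi> unfolding Cc_infty_r_def by blast+
  have n: "n \<ge> 3" using N by (simp add: n_def)
  have \<kappa>: "\<kappa> > 0" using n by (simp add: \<kappa>_def)
  have e: "norm e = 1" by (simp add: e_def)
  have line: "((\<lambda>t. \<phi> (t *\<^sub>R v)) has_real_derivative
      frechet_derivative \<phi> (at (t *\<^sub>R v)) v) (at t)" for v t
    using Cc_infty_line_derivative[OF C, of 0 v t] by simp
  have g: "(g has_real_derivative g' t) (at t)" for t
    using line[of e t] by (simp add: g_def[abs_def] g'_def)
  have g'_cont: "continuous_on UNIV g'"
    unfolding g'_def[abs_def]
    by (rule continuous_on_compose2[OF Cc_infty_continuous_on[OF Cc_infty_derivative[OF C], of UNIV e]])
       (auto intro!: continuous_intros)
  then have g'_isCont: "isCont g' t" for t by (simp add: continuous_on_eq_continuous_at)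
  have [measurable]: "g' \<in> borel_measurable borel"
    using g'_cont by (rule borel_measurable_continuous_onI)
  have le_grad: "\<bar>g' (norm y)\<bar> \<le> norm (gradient \<phi> y)" if "y \<noteq> 0" for y
  proof -
    define v where "v = (1 / norm y) *\<^sub>R y"
    have v: "norm v = 1" "norm y *\<^sub>R v = y" using that by (auto simp: v_def)
    have "((\<lambda>t. \<phi> (t *\<^sub>R v)) has_real_derivative g' (norm y)) (at (norm y))"
    proof (rule has_field_derivative_transform_within_open[OF g])
      show "g t = \<phi> (t *\<^sub>R v)" if "t \<in> {0<..}" for t
        unfolding g_def using e v by (intro rad) simp
    qed (use that in auto)
    then have "frechet_derivative \<phi> (at y) v = g' (norm y)"
      using DERIV_unique line[of v "norm y"] v by auto
    then show ?thesis
      using Cauchy_Schwarz_ineq2[of "gradient \<phi> y" v] v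
      by (simp add: frechet_derivative_eq_inner_gradient[OF C])
  qed
  have energy: "(\<integral>\<^sup>+s. ennreal (\<kappa> * s ^ (CARD('n) - 1) * (g' s)\<^sup>2) * indicator {0..} s \<partial>lborel) \<le> ennreal A"
  proof -
    have "(\<integral>\<^sup>+s. ennreal (\<kappa> * s ^ (CARD('n) - 1) * (g' s)\<^sup>2) * indicator {0..} s \<partial>lborel)
        = (\<integral>\<^sup>+s. ennreal (\<kappa> * s ^ (CARD('n) - 1)) * indicator {0..} s * ennreal ((g' s)\<^sup>2) \<partial>lborel)"
      using \<kappa> by (intro nn_integral_cong) (auto split: split_indicator simp: ennreal_mult)
    also have "\<dots> = (\<integral>\<^sup>+y. ennreal ((g' (norm (y::real^'n)))\<^sup>2) \<partial>lborel)"
      unfolding \<kappa>_def n_def by (subst nn_integral_radial) simp_all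
    also have "\<dots> \<le> (\<integral>\<^sup>+y. ennreal ((norm (gradient \<phi> y))\<^sup>2) \<partial>lborel)"
    proof (rule nn_integral_mono_AE)
      have "AE y in lborel. y \<noteq> (0::real^'n)" by (rule AE_lborel_singleton)
      then show "AE y in lborel. ennreal ((g' (norm y))\<^sup>2) \<le> ennreal ((norm (gradient \<phi> y))\<^sup>2)"
      proof eventually_elim
        case (elim y)
        show ?case using power_mono[OF le_grad[OF elim], of 2] by (intro ennreal_leI) simp
      qed
    qed
    finally show ?thesis using A(1) by simp
  qed
  define r where "r = norm x"
  define \<gamma> where "\<gamma> = (n - 2) / 2"
  define l where "l = r powr (- \<gamma>)"
  have r: "r > 0" and l: "l > 0" using x by (auto simp: r_def l_def)
  obtain R0 where R0: "\<And>y. norm y \<ge> R0 \<Longrightarrow> \<phi> y = 0"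
    using Cc_infty_bounded_support[OF C] by metis
  define R where "R = max r R0"
  have R: "R \<ge> r" "g R = 0" using R0[of "R *\<^sub>R e"] e r by (auto simp: R_def g_def)
  have amgm: "\<bar>y\<bar> \<le> l / 2 * (\<kappa> * s ^ (CARD('n) - 1) * y\<^sup>2) + 1 / (2 * l * \<kappa>) * s powr (1 - n)"
    if "s > 0" for y s
  proof -
    define z where "z = l * \<kappa> * s ^ (CARD('n) - 1)"
    have z: "z > 0" using that l \<kappa> by (simp add: z_def)
    have "0 \<le> (z * \<bar>y\<bar> - 1)\<^sup>2 / (2 * z)" using z by simp
    also have "\<dots> = (z * y\<^sup>2 + 1 / z) / 2 - \<bar>y\<bar>"
      using z by (simp add: power2_eq_square field_simps)
    finally have le: "\<bar>y\<bar> \<le> (z * y\<^sup>2 + 1 / z) / 2" by simp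
    have "s ^ (CARD('n) - 1) = s powr (n - 1)"
      using that n by (simp add: n_def of_nat_diff flip: powr_realpow)
    then have "1 / s ^ (CARD('n) - 1) = s powr (- (n - 1))"
      by (simp only: powr_minus_divide)
    moreover have "1 / z = 1 / (l * \<kappa>) * (1 / s ^ (CARD('n) - 1))" by (simp add: z_def)
    ultimately have z': "1 / z = 1 / (l * \<kappa>) * s powr (1 - n)" by (simp only: minus_diff_eq)
    show ?thesis using le unfolding z' by (simp add: z_def algebra_simps add_divide_distrib)
  qed
  have "\<phi> x = g r" unfolding g_def using e r by (intro rad) (simp add: r_def)
  then have "ennreal \<bar>\<phi> x\<bar> = ennreal (norm (\<integral>s. g' s * indicator {r..R} s \<partial>lborel))"
    using R by (subst integral_FTC_Icc_real[of r R g g']) (auto simp: g g'_isCont)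
  also have "\<dots> \<le> (\<integral>\<^sup>+s. norm (g' s * indicator {r..R} s) \<partial>lborel)"
  proof (rule integral_norm_bound_ennreal)
    show "integrable lborel (\<lambda>s. g' s * indicator {r..R} s)"
      using borel_integrable_atLeastAtMost[of r R g'] g'_isCont
      by (auto simp: indicator_def if_distrib cong: if_cong)
  qed
  also have "\<dots> \<le> (\<integral>\<^sup>+s. ennreal (l / 2) * (ennreal (\<kappa> * s ^ (CARD('n) - 1) * (g' s)\<^sup>2) * indicator {0..} s)
      + ennreal (1 / (2 * l * \<kappa>)) * (ennreal (s powr (1 - n)) * indicator {r..} s) \<partial>lborel)"
  proof (rule nn_integral_mono)
    fix s :: real
    show "ennreal (norm (g' s * indicator {r..R} s)) \<le>
      ennreal (l / 2) * (ennreal (\<kappa> * s ^ (CARD('n) - 1) * (g' s)\<^sup>2) * indicator {0..} s)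
      + ennreal (1 / (2 * l * \<kappa>)) * (ennreal (s powr (1 - n)) * indicator {r..} s)"
    proof (cases "s \<in> {r..R}")
      case True
      then have s: "s > 0" "s \<ge> r" using r by auto
      define P where "P = \<kappa> * s ^ (CARD('n) - 1) * (g' s)\<^sup>2"
      have P: "P \<ge> 0" using \<kappa> s by (simp add: P_def)
      have "ennreal \<bar>g' s\<bar> \<le> ennreal (l / 2 * P + 1 / (2 * l * \<kappa>) * s powr (1 - n))"
        unfolding P_def by (intro ennreal_leI amgm s)
      also have "\<dots> = ennreal (l / 2) * ennreal P + ennreal (1 / (2 * l * \<kappa>)) * ennreal (s powr (1 - n))"
      proof -
        have "ennreal (l / 2 * P) = ennreal (l / 2) * ennreal P"
          using l P by (intro ennreal_mult) auto
        moreover have "ennreal (1 / (2 * l * \<kappa>) * s powr (1 - n))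
            = ennreal (1 / (2 * l * \<kappa>)) * ennreal (s powr (1 - n))"
          using l \<kappa> by (intro ennreal_mult) auto
        moreover have "l / 2 * P \<ge> 0" "1 / (2 * l * \<kappa>) * s powr (1 - n) \<ge> 0"
          using l P \<kappa> by auto
        ultimately show ?thesis by (metis ennreal_plus)
      qed
      finally show ?thesis using True s by (simp add: P_def)
    qed simp
  qed
  also have "\<dots> = ennreal (l / 2) * (\<integral>\<^sup>+s. ennreal (\<kappa> * s ^ (CARD('n) - 1) * (g' s)\<^sup>2) * indicator {0..} s \<partial>lborel)
      + ennreal (1 / (2 * l * \<kappa>)) * (\<integral>\<^sup>+s. ennreal (s powr (1 - n)) * indicator {r..} s \<partial>lborel)"
    by (subst nn_integral_add) (auto simp: nn_integral_cmult)
  also have "\<dots> \<le> ennreal (l / 2) * ennreal A + ennreal (1 / (2 * l * \<kappa>)) * ennreal (r powr (2 - n) / (n - 2))"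
    using power_integral_Ici[OF r, of "1 - n"] n
    by (intro add_mono mult_left_mono energy) simp_all
  also have "\<dots> = ennreal (l / 2 * A + 1 / (2 * l * \<kappa>) * (r powr (2 - n) / (n - 2)))"
  proof -
    have "ennreal (l / 2 * A) = ennreal (l / 2) * ennreal A"
      using l A by (intro ennreal_mult) auto
    moreover have "ennreal (1 / (2 * l * \<kappa>) * (r powr (2 - n) / (n - 2)))
        = ennreal (1 / (2 * l * \<kappa>)) * ennreal (r powr (2 - n) / (n - 2))"
      using l \<kappa> n by (intro ennreal_mult) auto
    moreover have "l / 2 * A \<ge> 0" "1 / (2 * l * \<kappa>) * (r powr (2 - n) / (n - 2)) \<ge> 0"
      using l A \<kappa> n by auto
    ultimately show ?thesis by (metis ennreal_plus)
  qed
  also have "l / 2 * A + 1 / (2 * l * \<kappa>) * (r powr (2 - n) / (n - 2)) = (A + 1 / (\<kappa> * (n - 2))) / 2 * l"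
  proof -
    have "2 - n = - \<gamma> + - \<gamma>" by (simp add: \<gamma>_def)
    then have "r powr (2 - n) = l * l" unfolding l_def by (metis powr_add)
    then show ?thesis using l \<kappa> n by (simp add: field_simps)
  qed
  finally have "\<bar>\<phi> x\<bar> \<le> (A + 1 / (\<kappa> * (n - 2))) / 2 * l"
    using A \<kappa> n l by (subst (asm) ennreal_le_iff) auto
  then show ?thesis by (simp add: l_def r_def \<gamma>_def \<kappa>_def n_def)
qed

lemma integrable_norm_gradient_squared:
  fixes \<phi> :: "real^'n \<Rightarrow> real"
  assumes "\<phi> \<in> Cc_infty"
  shows "integrable lborel (\<lambda>x. (norm (gradient \<phi> x))\<^sup>2)"
proof -
  have "integrable lborel (\<lambda>x. \<Sum>i\<in>UNIV. frechet_derivative \<phi> (at x) (axis i 1) * frechet_derivative \<phi> (at x) (axis i 1))"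
    by (intro Bochner_Integration.integrable_sum Cc_infty_integrable Cc_infty_mult Cc_infty_derivative assms)
  then show ?thesis
    by (simp add: gradient_def norm_vec_def L2_set_def sum_nonneg power2_eq_square)
qed

lemma norm_diff_squared_le:
  fixes a b :: "'a::real_inner"
  shows "(norm (a - b))\<^sup>2 \<le> 2 * (norm a)\<^sup>2 + 2 * (norm b)\<^sup>2"
proof -
  have "0 \<le> (norm (a + b))\<^sup>2" by simp
  then show ?thesis
    by (simp add: power2_norm_eq_inner inner_add_left inner_add_right inner_diff_left inner_diff_right
        inner_commute)
qed

text \<open>The approximating test functions have bounded energy: \<open>\<bar>\<nabla>\<phi>\<bar>\<^sup>2 \<le> 2 * \<bar>G\<bar>\<^sup>2 + 2 * \<bar>H\<bar>\<^sup>2\<close>, where \<open>G\<close> and \<open>H\<close> are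
weak gradients of \<open>u\<close> and \<open>u - \<phi>\<close>, and each of these has square integral at most \<open>1\<close>.\<close>

lemma D12_r_approx:
  fixes u :: "real^'n \<Rightarrow> real"
  assumes u: "u \<in> D12_r" "norm12 u \<le> 1" and \<epsilon>: "0 < \<epsilon>" "\<epsilon> \<le> 1"
  obtains \<phi> H where "\<phi> \<in> Cc_infty_r" "has_weak_gradient (\<lambda>x. u x - \<phi> x) H"
    "integrable lborel (\<lambda>x. (norm (H x))\<^sup>2)" "(\<integral>x. (norm (H x))\<^sup>2 \<partial>lborel) \<le> \<epsilon>\<^sup>2"
    "(\<integral>\<^sup>+x. ennreal ((norm (gradient \<phi> x))\<^sup>2) \<partial>lborel) \<le> ennreal 4"
proof -
  obtain G where G: "has_weak_gradient u G" "integrable lborel (\<lambda>x. (norm (G x))\<^sup>2)"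
    using u by (auto simp: D12_r_def D12_def)
  obtain \<phi> where \<phi>: "\<phi> \<in> Cc_infty_r" and close: "norm12 (\<lambda>x. u x - \<phi> x) < \<epsilon>"
    using u \<epsilon> by (auto simp: D12_r_def)
  have C: "\<phi> \<in> Cc_infty" using \<phi> by (simp add: Cc_infty_r_def)
  define H where "H x = G x - gradient \<phi> x" for x
  have H: "has_weak_gradient (\<lambda>x. u x - \<phi> x) H"
    unfolding H_def[abs_def] by (intro has_weak_gradient_diff G has_weak_gradient_Cc_infty C)
  have [measurable]: "G \<in> borel_measurable lborel" "H \<in> borel_measurable lborel"
    using G(1) H by (auto simp: has_weak_gradient_def locally_integrable_def)
  have intH: "integrable lborel (\<lambda>x. (norm (H x))\<^sup>2)"
  proof (rule Bochner_Integration.integrable_bound)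
    show "integrable lborel (\<lambda>x. 2 * (norm (G x))\<^sup>2 + 2 * (norm (gradient \<phi> x))\<^sup>2)"
      by (intro Bochner_Integration.integrable_add integrable_mult_right G(2)
          integrable_norm_gradient_squared C)
    show "AE x in lborel. norm ((norm (H x))\<^sup>2) \<le> norm (2 * (norm (G x))\<^sup>2 + 2 * (norm (gradient \<phi> x))\<^sup>2)"
      using norm_diff_squared_le[of "G x" "gradient \<phi> x" for x] by (auto simp: H_def)
  qed measurable
  have "norm12 (\<lambda>x. u x - \<phi> x) \<ge> 0" "norm12 u \<ge> 0" by (auto simp: norm12_def)
  then have "(norm12 (\<lambda>x. u x - \<phi> x))\<^sup>2 \<le> \<epsilon>\<^sup>2" "(norm12 u)\<^sup>2 \<le> 1"
    using close u(2) by (auto intro: power_mono power_le_one)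
  then have H\<epsilon>: "(\<integral>x. (norm (H x))\<^sup>2 \<partial>lborel) \<le> \<epsilon>\<^sup>2" and G1: "(\<integral>x. (norm (G x))\<^sup>2 \<partial>lborel) \<le> 1"
    by (simp_all add: norm12_squared[OF H] norm12_squared[OF G(1)])
  have "(\<integral>x. (norm (gradient \<phi> x))\<^sup>2 \<partial>lborel) \<le> (\<integral>x. 2 * (norm (G x))\<^sup>2 + 2 * (norm (H x))\<^sup>2 \<partial>lborel)"
  proof (rule integral_mono)
    show "(norm (gradient \<phi> x))\<^sup>2 \<le> 2 * (norm (G x))\<^sup>2 + 2 * (norm (H x))\<^sup>2" for x
      using norm_diff_squared_le[of "G x" "H x"] by (simp add: H_def)
  qed (intro Bochner_Integration.integrable_add integrable_mult_right G(2) intH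
      integrable_norm_gradient_squared C)+
  also have "\<dots> = 2 * (\<integral>x. (norm (G x))\<^sup>2 \<partial>lborel) + 2 * (\<integral>x. (norm (H x))\<^sup>2 \<partial>lborel)"
    using G(2) intH by simp
  also have "\<dots> \<le> 2 * 1 + 2 * \<epsilon>\<^sup>2" using H\<epsilon> G1 by simp
  also have "\<dots> \<le> 4" using power_le_one[of \<epsilon> 2] \<epsilon> by simp
  finally have "ennreal (\<integral>x. (norm (gradient \<phi> x))\<^sup>2 \<partial>lborel) \<le> ennreal 4"
    by (rule ennreal_leI)
  then have "(\<integral>\<^sup>+x. ennreal ((norm (gradient \<phi> x))\<^sup>2) \<partial>lborel) \<le> ennreal 4"
    using integrable_norm_gradient_squared[OF C] by (subst nn_integral_eq_integral) auto
  with \<phi> H intH H\<epsilon> show ?thesis by (rule that)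
qed

text \<open>The pairing equals that of \<open>H $ i\<close> with \<open>- \<Psi>\<close>, and \<open>\<bar>H $ i * \<Psi>\<bar> \<le> \<bar>H\<bar>\<^sup>2 / (2 * \<epsilon>) + \<epsilon> / 2 * \<Psi>\<^sup>2\<close>.\<close>

lemma weak_derivative_pairing_le:
  fixes v :: "real^'n \<Rightarrow> real"
  assumes H: "has_weak_gradient v H" "integrable lborel (\<lambda>x. (norm (H x))\<^sup>2)"
    and \<epsilon>: "(\<integral>x. (norm (H x))\<^sup>2 \<partial>lborel) \<le> \<epsilon>\<^sup>2" "\<epsilon> > 0" and \<Psi>: "\<Psi> \<in> Cc_infty"
  shows "\<bar>\<integral>x. v x * frechet_derivative \<Psi> (at x) (axis i 1) \<partial>lborel\<bar>
    \<le> \<epsilon> * (1 + (\<integral>x. \<Psi> x * \<Psi> x \<partial>lborel)) / 2"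
proof -
  have int\<Psi>: "integrable lborel (\<lambda>x. \<Psi> x * \<Psi> x)"
    by (intro Cc_infty_integrable Cc_infty_mult \<Psi>)
  have "\<bar>\<integral>x. v x * frechet_derivative \<Psi> (at x) (axis i 1) \<partial>lborel\<bar> = \<bar>\<integral>x. H x $ i * \<Psi> x \<partial>lborel\<bar>"
    using H(1) \<Psi> by (simp add: has_weak_gradient_def)
  also have "\<dots> \<le> (\<integral>x. \<bar>H x $ i * \<Psi> x\<bar> \<partial>lborel)" by (rule integral_abs_bound)
  also have "\<dots> \<le> (\<integral>x. (1 / (2 * \<epsilon>)) * (norm (H x))\<^sup>2 + (\<epsilon> / 2) * (\<Psi> x * \<Psi> x) \<partial>lborel)"
  proof (rule integral_mono)
    have "locally_integrable (\<lambda>x. H x $ i)"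
      using H(1) by (intro locally_integrable_component) (simp add: has_weak_gradient_def)
    then show "integrable lborel (\<lambda>x. \<bar>H x $ i * \<Psi> x\<bar>)"
      by (intro integrable_abs locally_integrable_mult_Cc_infty \<Psi>)
    fix x
    have "\<bar>H x $ i * \<Psi> x\<bar> \<le> norm (H x) * \<bar>\<Psi> x\<bar>"
      unfolding abs_mult by (intro mult_right_mono component_le_norm_cart) simp
    also have "\<dots> \<le> (1 / (2 * \<epsilon>)) * (norm (H x))\<^sup>2 + (\<epsilon> / 2) * (\<Psi> x * \<Psi> x)"
    proof -
      have "0 \<le> (norm (H x) - \<epsilon> * \<bar>\<Psi> x\<bar>)\<^sup>2 / (2 * \<epsilon>)" using \<epsilon> by simp
      also have "\<dots> = (1 / (2 * \<epsilon>)) * (norm (H x))\<^sup>2 + (\<epsilon> / 2) * (\<bar>\<Psi> x\<bar> * \<bar>\<Psi> x\<bar>) - norm (H x) * \<bar>\<Psi> x\<bar>"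
        using \<epsilon>(2) by (simp add: power2_eq_square field_simps del: abs_mult_self_eq abs_mult_self)
      finally show ?thesis by simp
    qed
    finally show "\<bar>H x $ i * \<Psi> x\<bar> \<le> (1 / (2 * \<epsilon>)) * (norm (H x))\<^sup>2 + (\<epsilon> / 2) * (\<Psi> x * \<Psi> x)" .
  qed (intro Bochner_Integration.integrable_add integrable_mult_right H(2) int\<Psi>)
  also have "\<dots> = (1 / (2 * \<epsilon>)) * (\<integral>x. (norm (H x))\<^sup>2 \<partial>lborel) + (\<epsilon> / 2) * (\<integral>x. \<Psi> x * \<Psi> x \<partial>lborel)"
    using H(2) int\<Psi> by simp
  also have "\<dots> \<le> (1 / (2 * \<epsilon>)) * \<epsilon>\<^sup>2 + (\<epsilon> / 2) * (\<integral>x. \<Psi> x * \<Psi> x \<partial>lborel)"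
    using \<epsilon> by (intro add_right_mono mult_left_mono) auto
  also have "\<dots> = \<epsilon> * (1 + (\<integral>x. \<Psi> x * \<Psi> x \<partial>lborel)) / 2"
    using \<epsilon>(2) by (simp add: power2_eq_square field_simps)
  finally show ?thesis .
qed

section \<open>Pointwise decay in the radial space\<close>

lemma box_bump_translate:
  "box_bump c a b (x - v) = box_bump c (a + v) (b + v) x"
  by (simp add: box_bump_def bump_def algebra_simps)

text \<open>Integrated over a box, this bounds the average of an \<open>L\<^sup>p\<close> function by \<open>\<eta>\<close> plus a tail of the integral of
\<open>\<bar>u\<bar>\<^sup>p\<close>, so that averages over boxes of fixed size vanish at infinity.\<close>

lemma abs_le_tail_split:
  fixes t \<eta> p :: real
  assumes "\<eta> > 0" "p \<ge> 1"
  shows "\<bar>t\<bar> \<le> \<eta> + \<eta> powr (1 - p) * \<bar>t\<bar> powr p"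
proof (cases "\<bar>t\<bar> \<le> \<eta>")
  case True
  have "0 \<le> \<eta> powr (1 - p) * \<bar>t\<bar> powr p" by simp
  with True show ?thesis by linarith
next
  case False
  then have t: "\<bar>t\<bar> > 0" "\<eta> \<le> \<bar>t\<bar>" using assms by auto
  then have "\<bar>t\<bar> = \<bar>t\<bar> powr (1 - p) * \<bar>t\<bar> powr p"
    by (simp flip: powr_add)
  also have "\<dots> \<le> \<eta> powr (1 - p) * \<bar>t\<bar> powr p"
    using assms t by (intro mult_right_mono powr_mono2') auto
  finally show ?thesis using assms by linarith
qed

lemma tail_integral_tendsto_0:
  fixes f :: "real^'n \<Rightarrow> real"
  assumes f: "integrable lborel f"
  shows "((\<lambda>t. \<integral>x. indicator (- ball 0 (t - M)) x * f x \<partial>lborel) \<longlongrightarrow> 0) at_top"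
proof -
  have [measurable]: "f \<in> borel_measurable lborel" using f by simp
  have "((\<lambda>t. \<integral>x. indicator (- ball 0 (t - M)) x * f x \<partial>lborel) \<longlongrightarrow> integral\<^sup>L lborel (\<lambda>x::real^'n. 0 :: real)) at_top"
  proof (rule integral_dominated_convergence_at_top[where w = "\<lambda>x. \<bar>f x\<bar>"])
    show "AE x in lborel. ((\<lambda>t. indicator (- ball 0 (t - M)) x * f x) \<longlongrightarrow> 0) at_top"
    proof (rule AE_I2)
      fix x :: "real^'n"
      have "eventually (\<lambda>t. indicator (- ball 0 (t - M)) x * f x = 0) at_top"
        using eventually_gt_at_top[of "norm x + M"] by eventually_elim simp
      then show "((\<lambda>t. indicator (- ball 0 (t - M)) x * f x) \<longlongrightarrow> 0) at_top"
        by (rule tendsto_eventually)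
    qed
    show "\<forall>\<^sub>F t in at_top. AE x in lborel. norm (indicator (- ball 0 (t - M)) x * f x) \<le> \<bar>f x\<bar>"
      by (intro always_eventually allI AE_I2) (auto split: split_indicator)
  qed (use f in auto)
  then show ?thesis by simp
qed

text \<open>The constant is that of \<open>radial_pointwise_bound\<close> for the energy bound \<open>4\<close> of \<open>D12_r_approx\<close>.\<close>

context
  fixes u :: "real^'n \<Rightarrow> real" and C \<gamma> :: real
  assumes N: "CARD('n) \<ge> 3" and u: "u \<in> D12_r" "norm12 u \<le> 1"
  defines "C \<equiv> (4 + 1 / (real CARD('n) * unit_ball_vol (real CARD('n)) * (real CARD('n) - 2))) / 2"
    and "\<gamma> \<equiv> (real CARD('n) - 2) / 2"
begin

lemma decay_constants_pos: "C > 0" "\<gamma> > 0"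
proof -
  have "real CARD('n) - 2 > 0" using N by simp
  moreover have "real CARD('n) * unit_ball_vol (real CARD('n)) \<ge> 0" by simp
  ultimately have q: "1 / (real CARD('n) * unit_ball_vol (real CARD('n)) * (real CARD('n) - 2)) \<ge> 0"
    by (intro divide_nonneg_nonneg mult_nonneg_nonneg) auto
  show "C > 0" unfolding C_def by (intro divide_pos_pos add_pos_nonneg q) auto
  show "\<gamma> > 0" using N by (simp add: \<gamma>_def)
qed

lemma D12_r_locally_integrable: "locally_integrable u"
  using u by (auto simp: D12_r_def D12_def has_weak_gradient_def)

text \<open>The difference \<open>b - b\<^sub>h\<close> of the bumps is \<open>\<partial>\<^sub>i\<Psi>\<close> for a test function \<open>\<Psi>\<close>.  For a radial test function \<open>\<phi>\<close>
close to \<open>u\<close> in energy, the integral of \<open>(u - \<phi>) * \<partial>\<^sub>i\<Psi>\<close> is small, and the integrals of \<open>\<phi> * b\<close> and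
\<open>\<phi> * b\<^sub>h\<close> are controlled by the pointwise bound for \<open>\<phi>\<close>.\<close>

lemma abs_integral_le_translate:
  assumes c: "c > 0"
    and \<omega>: "\<And>x. x \<in> box a b \<Longrightarrow> x \<noteq> 0 \<and> norm x powr - \<gamma> \<le> \<omega>1"
      "\<And>x. x \<in> box (a + h *\<^sub>R axis i 1) (b + h *\<^sub>R axis i 1) \<Longrightarrow> x \<noteq> 0 \<and> norm x powr - \<gamma> \<le> \<omega>2"
  shows "\<bar>\<integral>x. u x * box_bump c a b x \<partial>lborel\<bar>
    \<le> \<bar>\<integral>x. u x * box_bump c (a + h *\<^sub>R axis i 1) (b + h *\<^sub>R axis i 1) x \<partial>lborel\<bar>
      + C * (\<omega>1 + \<omega>2) * (\<integral>x. box_bump c a b x \<partial>lborel)"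
proof -
  define b1 where "b1 = box_bump c a b"
  define b2 where "b2 = box_bump c (a + h *\<^sub>R axis i 1) (b + h *\<^sub>R axis i 1)"
  have b12: "b1 \<in> Cc_infty" "b2 \<in> Cc_infty"
    using c by (auto simp: b1_def b2_def intro: box_bump_Cc_infty)
  have b2_eq: "b2 x = b1 (x + - (h *\<^sub>R axis i 1))" for x
    using box_bump_translate[of c a b x "h *\<^sub>R axis i 1"] by (simp add: b1_def b2_def)
  have same: "(\<integral>x. b2 x \<partial>lborel) = (\<integral>x. b1 x \<partial>lborel)"
    unfolding b2_eq by (rule integral_translate) (rule Cc_infty_measurable[OF b12(1)])
  obtain \<Psi> where \<Psi>: "\<Psi> \<in> Cc_infty"
      and d\<Psi>: "\<And>x. frechet_derivative \<Psi> (at x) (axis i 1) = b1 x - b2 x"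
    using box_bump_minus_translate_eq_derivative[OF c, of i a b h]
    unfolding box_bump_translate[of c a b] b1_def b2_def[symmetric] by blast
  define Q where "Q = (1 + (\<integral>x. \<Psi> x * \<Psi> x \<partial>lborel)) / 2"
  define L where "L = \<bar>\<integral>x. u x * b1 x \<partial>lborel\<bar>"
  define B where "B = \<bar>\<integral>x. u x * b2 x \<partial>lborel\<bar> + C * (\<omega>1 + \<omega>2) * (\<integral>x. b1 x \<partial>lborel)"
  have int: "integrable lborel (\<lambda>x. u x * b1 x)" "integrable lborel (\<lambda>x. u x * b2 x)"
    by (intro locally_integrable_mult_Cc_infty D12_r_locally_integrable b12)+
  have approx: "L \<le> B + \<epsilon> * Q" if \<epsilon>: "0 < \<epsilon>" "\<epsilon> \<le> 1" for \<epsilon>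
  proof -
    obtain \<phi> H where \<phi>: "\<phi> \<in> Cc_infty_r" "has_weak_gradient (\<lambda>x. u x - \<phi> x) H"
        "integrable lborel (\<lambda>x. (norm (H x))\<^sup>2)" "(\<integral>x. (norm (H x))\<^sup>2 \<partial>lborel) \<le> \<epsilon>\<^sup>2"
      and en: "(\<integral>\<^sup>+x. ennreal ((norm (gradient \<phi> x))\<^sup>2) \<partial>lborel) \<le> ennreal 4"
      by (rule D12_r_approx[OF u \<epsilon>])
    have \<phi>C: "\<phi> \<in> Cc_infty" using \<phi>(1) by (simp add: Cc_infty_r_def)
    have int\<phi>: "integrable lborel (\<lambda>x. \<phi> x * b1 x)" "integrable lborel (\<lambda>x. \<phi> x * b2 x)"
      by (intro locally_integrable_mult_Cc_infty locally_integrable_Cc_infty \<phi>C b12)+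
    have pt: "\<bar>\<phi> x\<bar> \<le> C * norm x powr - \<gamma>" if "x \<noteq> 0" for x
      using radial_pointwise_bound[OF N \<phi>(1) en _ that] by (simp add: C_def \<gamma>_def)
    have part: "\<bar>\<integral>x. \<phi> x * box_bump c a' b' x \<partial>lborel\<bar> \<le> C * \<omega> * (\<integral>x. box_bump c a' b' x \<partial>lborel)"
      if *: "\<And>x. x \<in> box a' b' \<Longrightarrow> x \<noteq> 0 \<and> norm x powr - \<gamma> \<le> \<omega>" for a' b' \<omega>
    proof -
      have bb: "box_bump c a' b' \<in> Cc_infty" by (rule box_bump_Cc_infty[OF c])
      have i1: "integrable lborel (\<lambda>x. \<phi> x * box_bump c a' b' x)"
        by (intro locally_integrable_mult_Cc_infty locally_integrable_Cc_infty \<phi>C bb)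
      have "\<bar>\<integral>x. \<phi> x * box_bump c a' b' x \<partial>lborel\<bar> \<le> (\<integral>x. \<bar>\<phi> x * box_bump c a' b' x\<bar> \<partial>lborel)"
        by (rule integral_abs_bound)
      also have "\<dots> \<le> (\<integral>x. C * \<omega> * box_bump c a' b' x \<partial>lborel)"
      proof (rule integral_mono)
        show "integrable lborel (\<lambda>x. \<bar>\<phi> x * box_bump c a' b' x\<bar>)"
          by (rule integrable_abs[OF i1])
        show "integrable lborel (\<lambda>x. C * \<omega> * box_bump c a' b' x)"
          by (intro integrable_mult_right Cc_infty_integrable bb)
        fix x
        show "\<bar>\<phi> x * box_bump c a' b' x\<bar> \<le> C * \<omega> * box_bump c a' b' x"
        proof (cases "x \<in> box a' b'")
          case True
          have "\<bar>\<phi> x\<bar> \<le> C * norm x powr - \<gamma>" using * True pt by blast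
          also have "\<dots> \<le> C * \<omega>"
            using *[OF True] decay_constants_pos by (intro mult_left_mono) auto
          finally show ?thesis
            using box_bump_range[OF c, of a' b' x] by (simp add: abs_mult mult_right_mono)
        qed (simp add: box_bump_eq_0)
      qed
      finally show ?thesis by simp
    qed
    have "(\<integral>x. (u x - \<phi> x) * frechet_derivative \<Psi> (at x) (axis i 1) \<partial>lborel)
        = (\<integral>x. u x * b1 x \<partial>lborel) - (\<integral>x. u x * b2 x \<partial>lborel)
          - ((\<integral>x. \<phi> x * b1 x \<partial>lborel) - (\<integral>x. \<phi> x * b2 x \<partial>lborel))"
      unfolding d\<Psi> left_diff_distrib right_diff_distrib using int int\<phi> by simp
    moreover have "\<bar>\<integral>x. (u x - \<phi> x) * frechet_derivative \<Psi> (at x) (axis i 1) \<partial>lborel\<bar> \<le> \<epsilon> * Q"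
      using weak_derivative_pairing_le[OF \<phi>(2-4) \<epsilon>(1) \<Psi>, of i] by (simp add: Q_def)
    moreover have "\<bar>\<integral>x. \<phi> x * b1 x \<partial>lborel\<bar> \<le> C * \<omega>1 * (\<integral>x. b1 x \<partial>lborel)"
      unfolding b1_def by (rule part[OF \<omega>(1)])
    moreover have "\<bar>\<integral>x. \<phi> x * b2 x \<partial>lborel\<bar> \<le> C * \<omega>2 * (\<integral>x. b2 x \<partial>lborel)"
      unfolding b2_def by (rule part[OF \<omega>(2)])
    ultimately have "L \<le> \<bar>\<integral>x. u x * b2 x \<partial>lborel\<bar> + C * \<omega>1 * (\<integral>x. b1 x \<partial>lborel)
        + C * \<omega>2 * (\<integral>x. b1 x \<partial>lborel) + \<epsilon> * Q"
      unfolding L_def same by linarith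
    also have "\<dots> = B + \<epsilon> * Q" by (simp add: B_def algebra_simps)
    finally show ?thesis .
  qed
  have "L \<le> B"
  proof (rule tendsto_lowerbound)
    show "((\<lambda>\<epsilon>. B + \<epsilon> * Q) \<longlongrightarrow> B) (at_right 0)"
      by (auto intro!: tendsto_eq_intros)
    show "\<forall>\<^sub>F \<epsilon> in at_right 0. L \<le> B + \<epsilon> * Q"
      using eventually_at_right_real[of 0 1] by (rule eventually_mono) (auto intro: approx)
  qed simp
  then show ?thesis by (simp add: L_def B_def b1_def b2_def)
qed

text \<open>Let the translate of the bump run off to infinity.  Its contribution vanishes: the decay bound tends
to \<open>0\<close> there, and \<open>u\<close> has a finite integral of \<open>\<bar>u\<bar>\<^sup>p\<close>.  This is where the nonzero constants, which
have gradient \<open>0\<close>, are ruled out.\<close>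

lemma abs_integral_box_bump_le:
  assumes c: "c > 0"
    and \<omega>: "\<And>x. x \<in> box a b \<Longrightarrow> x \<noteq> 0 \<and> norm x powr - \<gamma> \<le> \<omega>"
  shows "\<bar>\<integral>x. u x * box_bump c a b x \<partial>lborel\<bar> \<le> C * \<omega> * (\<integral>x. box_bump c a b x \<partial>lborel)"
proof -
  define i :: 'n where "i = undefined"
  define p where "p = 2 * real CARD('n) / (real CARD('n) - 2)"
  have p: "p \<ge> 1" using N by (simp add: p_def field_simps)
  have um[measurable]: "u \<in> borel_measurable lborel"
    using u by (auto simp: D12_r_def D12_def)
  have up: "integrable lborel (\<lambda>x. \<bar>u x\<bar> powr p)"
    using u by (auto simp: D12_r_def D12_def p_def)
  have "bounded (box a b)" by (rule bounded_box)
  then obtain M where M: "\<And>x. x \<in> box a b \<Longrightarrow> norm x \<le> M"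
    unfolding bounded_iff by blast
  define I where "I = (\<integral>x. box_bump c a b x \<partial>lborel)"
  define T where "T t = (\<integral>x. indicator (- ball 0 (t - M)) x * \<bar>u x\<bar> powr p \<partial>lborel)" for t
  \<comment> \<open>a translate by \<open>t\<close> of a box inside the ball of radius \<open>M\<close> avoids the ball of radius \<open>t - M\<close>\<close>
  have far: "norm x \<ge> t - M" if x: "x \<in> box (a + t *\<^sub>R axis i 1) (b + t *\<^sub>R axis i 1)" and "t > 0" for t x
  proof -
    have "x - t *\<^sub>R axis i 1 \<in> box a b"
      using x by (auto simp: mem_box_cart algebra_simps)
    then have "norm (x - t *\<^sub>R axis i 1) \<le> M" by (rule M)
    moreover have "norm (t *\<^sub>R (axis i 1 :: real^'n)) = t" using that by simp
    ultimately show ?thesis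
      using norm_triangle_ineq2[of "t *\<^sub>R axis i 1" x] by (simp add: norm_minus_commute)
  qed
  have bound: "\<bar>\<integral>x. u x * box_bump c a b x \<partial>lborel\<bar>
      \<le> \<eta> * I + \<eta> powr (1 - p) * T t + C * (\<omega> + (t - M) powr - \<gamma>) * I"
    if t: "t > M" "t > 0" and \<eta>: "\<eta> > 0" for t \<eta>
  proof -
    define b2 where "b2 = box_bump c (a + t *\<^sub>R axis i 1) (b + t *\<^sub>R axis i 1)"
    have b2: "b2 \<in> Cc_infty" unfolding b2_def by (rule box_bump_Cc_infty[OF c])
    have "b2 x = box_bump c a b (x + - (t *\<^sub>R axis i 1))" for x
      using box_bump_translate[of c a b x "t *\<^sub>R axis i 1"] by (simp add: b2_def)
    then have I2: "(\<integral>x. b2 x \<partial>lborel) = I"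
      unfolding I_def using integral_translate[OF Cc_infty_measurable[OF box_bump_Cc_infty[OF c]], of a b "- (t *\<^sub>R axis i 1)"]
      by simp
    have "\<bar>\<integral>x. u x * box_bump c a b x \<partial>lborel\<bar>
        \<le> \<bar>\<integral>x. u x * b2 x \<partial>lborel\<bar> + C * (\<omega> + (t - M) powr - \<gamma>) * I"
      unfolding I_def b2_def
    proof (rule abs_integral_le_translate[OF c \<omega>])
      fix x assume "x \<in> box (a + t *\<^sub>R axis i 1) (b + t *\<^sub>R axis i 1)"
      from far[OF this t(2)] show "x \<noteq> 0 \<and> norm x powr - \<gamma> \<le> (t - M) powr - \<gamma>"
        using t decay_constants_pos by (auto intro!: powr_mono2')
    qed
    moreover have "\<bar>\<integral>x. u x * b2 x \<partial>lborel\<bar> \<le> \<eta> * I + \<eta> powr (1 - p) * T t"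
    proof -
      have ind: "integrable lborel (\<lambda>x. indicator (- ball 0 (t - M)) x * \<bar>u x\<bar> powr p)"
        using integrable_mult_indicator[OF _ up, of "- ball 0 (t - M)"] by simp
      have "\<bar>\<integral>x. u x * b2 x \<partial>lborel\<bar> \<le> (\<integral>x. \<bar>u x * b2 x\<bar> \<partial>lborel)" by (rule integral_abs_bound)
      also have "\<dots> \<le> (\<integral>x. \<eta> * b2 x
          + \<eta> powr (1 - p) * (indicator (- ball 0 (t - M)) x * \<bar>u x\<bar> powr p) \<partial>lborel)"
      proof (rule integral_mono)
        show "integrable lborel (\<lambda>x. \<bar>u x * b2 x\<bar>)"
          by (intro integrable_abs locally_integrable_mult_Cc_infty D12_r_locally_integrable b2)
        show "integrable lborel (\<lambda>x. \<eta> * b2 x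
          + \<eta> powr (1 - p) * (indicator (- ball 0 (t - M)) x * \<bar>u x\<bar> powr p))"
          by (intro Bochner_Integration.integrable_add integrable_mult_right ind Cc_infty_integrable b2)
        fix x
        show "\<bar>u x * b2 x\<bar> \<le> \<eta> * b2 x + \<eta> powr (1 - p) * (indicator (- ball 0 (t - M)) x * \<bar>u x\<bar> powr p)"
        proof (cases "x \<in> box (a + t *\<^sub>R axis i 1) (b + t *\<^sub>R axis i 1)")
          case True
          have r: "0 \<le> b2 x" "b2 x \<le> 1" using box_bump_range[OF c] by (auto simp: b2_def)
          have "\<bar>u x * b2 x\<bar> \<le> (\<eta> + \<eta> powr (1 - p) * \<bar>u x\<bar> powr p) * b2 x"
            unfolding abs_mult using r abs_le_tail_split[OF \<eta> p, of "u x"] by (simp add: mult_right_mono)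
          also have "\<dots> \<le> \<eta> * b2 x + \<eta> powr (1 - p) * \<bar>u x\<bar> powr p"
            using mult_left_mono[OF r(2), of "\<eta> powr (1 - p) * \<bar>u x\<bar> powr p"] by (simp add: algebra_simps)
          finally show ?thesis using far[OF True t(2)] by simp
        qed (simp add: b2_def box_bump_eq_0)
      qed
      also have "\<dots> = \<eta> * I + \<eta> powr (1 - p) * T t"
        using ind Cc_infty_integrable[OF b2] by (simp add: T_def I2)
      finally show ?thesis .
    qed
    ultimately show ?thesis by linarith
  qed
  \<comment> \<open>first \<open>t \<rightarrow> \<infinity>\<close> for fixed \<open>\<eta>\<close>, then \<open>\<eta> \<rightarrow> 0\<close>\<close>
  have limit: "\<bar>\<integral>x. u x * box_bump c a b x \<partial>lborel\<bar> \<le> \<eta> * I + C * \<omega> * I" if \<eta>: "\<eta> > 0" for \<eta>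
  proof (rule tendsto_lowerbound)
    have "((\<lambda>t. (t - M) powr - \<gamma>) \<longlongrightarrow> 0) at_top"
      using decay_constants_pos
      by (intro tendsto_neg_powr filterlim_tendsto_add_at_top[of "\<lambda>_. - M" "- M" _ "\<lambda>t. t", simplified])
         (auto intro: filterlim_ident)
    moreover have "(T \<longlongrightarrow> 0) at_top"
      unfolding T_def[abs_def] by (rule tail_integral_tendsto_0[OF up])
    ultimately have "((\<lambda>t. \<eta> * I + \<eta> powr (1 - p) * T t + C * (\<omega> + (t - M) powr - \<gamma>) * I)
        \<longlongrightarrow> \<eta> * I + \<eta> powr (1 - p) * 0 + C * (\<omega> + 0) * I) at_top"
      by (intro tendsto_intros)
    then show "((\<lambda>t. \<eta> * I + \<eta> powr (1 - p) * T t + C * (\<omega> + (t - M) powr - \<gamma>) * I)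
        \<longlongrightarrow> \<eta> * I + C * \<omega> * I) at_top" by simp
    show "\<forall>\<^sub>F t in at_top. \<bar>\<integral>x. u x * box_bump c a b x \<partial>lborel\<bar>
        \<le> \<eta> * I + \<eta> powr (1 - p) * T t + C * (\<omega> + (t - M) powr - \<gamma>) * I"
      using eventually_gt_at_top[of "max M 0"] by (rule eventually_mono) (auto intro!: bound \<eta>)
  qed simp
  have "\<bar>\<integral>x. u x * box_bump c a b x \<partial>lborel\<bar> \<le> C * \<omega> * I"
  proof (rule tendsto_lowerbound)
    show "((\<lambda>\<eta>. \<eta> * I + C * \<omega> * I) \<longlongrightarrow> C * \<omega> * I) (at_right 0)"
      by (auto intro!: tendsto_eq_intros)
    show "\<forall>\<^sub>F \<eta> in at_right 0. \<bar>\<integral>x. u x * box_bump c a b x \<partial>lborel\<bar> \<le> \<eta> * I + C * \<omega> * I"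
      using eventually_at_right_less[of 0] by (rule eventually_mono) (rule limit)
  qed simp
  then show ?thesis by (simp add: I_def)
qed

lemma abs_integral_box_le:
  assumes \<omega>: "\<And>x. x \<in> box a b \<Longrightarrow> x \<noteq> 0 \<and> norm x powr - \<gamma> \<le> \<omega>"
  shows "\<bar>\<integral>x. u x * indicator (box a b) x \<partial>lborel\<bar> \<le> C * \<omega> * measure lborel (box a b)"
proof (rule LIMSEQ_le)
  show "(\<lambda>m. \<bar>\<integral>x. u x * box_bump (1 / real (Suc m)) a b x \<partial>lborel\<bar>)
      \<longlonglongrightarrow> \<bar>\<integral>x. u x * indicator (box a b) x \<partial>lborel\<bar>"
    by (intro tendsto_rabs integral_box_bump_tendsto D12_r_locally_integrable)
  have "(\<lambda>m. \<integral>x. 1 * box_bump (1 / real (Suc m)) a b x \<partial>lborel)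
      \<longlonglongrightarrow> (\<integral>x. 1 * indicator (box a b) x \<partial>lborel)"
    by (intro integral_box_bump_tendsto continuous_imp_locally_integrable continuous_on_const)
  then show "(\<lambda>m. C * \<omega> * (\<integral>x. box_bump (1 / real (Suc m)) a b x \<partial>lborel))
      \<longlonglongrightarrow> C * \<omega> * measure lborel (box a b)"
    by (intro tendsto_mult_left) simp
  show "\<exists>N. \<forall>m\<ge>N. \<bar>\<integral>x. u x * box_bump (1 / real (Suc m)) a b x \<partial>lborel\<bar>
      \<le> C * \<omega> * (\<integral>x. box_bump (1 / real (Suc m)) a b x \<partial>lborel)"
    using abs_integral_box_bump_le[OF _ \<omega>] by simp
qed

text \<open>On small boxes near \<open>x \<noteq> 0\<close> the function \<open>norm y powr - \<gamma>\<close> is close to its value at \<open>x\<close>, so the previous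
bound estimates the averages of \<open>u\<close> over these boxes.\<close>

lemma D12_r_decay: "AE x in lborel. x \<noteq> 0 \<longrightarrow> \<bar>u x\<bar> \<le> C * norm x powr - \<gamma>"
proof -
  have "AE x in lborel. x \<in> - {0} \<longrightarrow> \<bar>u x\<bar> \<le> C * norm x powr - \<gamma>"
  proof (rule AE_abs_le_if_box_averages_le[OF D12_r_locally_integrable])
    fix x :: "real^'n" and \<epsilon> :: real assume x: "x \<in> - {0}" and \<epsilon>: "\<epsilon> > 0"
    define \<omega> where "\<omega> = norm x powr - \<gamma> + \<epsilon> / C"
    have "((\<lambda>y. norm y powr - \<gamma>) \<longlongrightarrow> norm x powr - \<gamma>) (at x)"
      using x by (intro tendsto_intros) auto
    moreover have "\<epsilon> / C > 0" using \<epsilon> decay_constants_pos by simp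
    ultimately have "\<forall>\<^sub>F y in at x. dist (norm y powr - \<gamma>) (norm x powr - \<gamma>) < \<epsilon> / C"
      by (rule tendstoD)
    then obtain \<delta> where \<delta>: "\<delta> > 0"
        "\<And>y. y \<noteq> x \<Longrightarrow> dist y x < \<delta> \<Longrightarrow> dist (norm y powr - \<gamma>) (norm x powr - \<gamma>) < \<epsilon> / C"
      unfolding eventually_at by blast
    define \<rho> where "\<rho> = min \<delta> (norm x)"
    have near: "y \<noteq> 0 \<and> norm y powr - \<gamma> \<le> \<omega>" if y: "dist y x < \<rho>" for y
    proof -
      have "y \<noteq> 0" using y by (auto simp: \<rho>_def)
      moreover have "norm y powr - \<gamma> \<le> \<omega>"
      proof (cases "y = x")
        case True
        then show ?thesis using \<epsilon> decay_constants_pos by (simp add: \<omega>_def)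
      next
        case False
        then have "dist (norm y powr - \<gamma>) (norm x powr - \<gamma>) < \<epsilon> / C"
          using \<delta>(2) y by (simp add: \<rho>_def)
        then show ?thesis unfolding \<omega>_def dist_real_def by linarith
      qed
      ultimately show ?thesis by simp
    qed
    define S :: real where "S = real CARD('n)"
    have S: "S > 0" by (simp add: S_def)
    have \<rho>: "\<rho> > 0" using \<delta>(1) x by (simp add: \<rho>_def)
    show "\<exists>d>0. \<forall>h. 0 < h \<and> h < d \<longrightarrow>
      \<bar>\<integral>y. u y * indicator (box x (x + h *\<^sub>R One)) y \<partial>lborel\<bar>
        \<le> (C * norm x powr - \<gamma> + \<epsilon>) * h ^ CARD('n)"
    proof (intro exI[of _ "\<rho> / S"] conjI allI impI)
      show "\<rho> / S > 0" using \<rho> S by simp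
      fix h assume h: "0 < h \<and> h < \<rho> / S"
      have One: "(One :: real^'n) $ j = 1" for j
        using inner_sum_left_Basis[of "axis j 1 :: real^'n" "\<lambda>_. 1"] by (simp add: cart_eq_inner_axis)
      have "y \<noteq> 0 \<and> norm y powr - \<gamma> \<le> \<omega>" if y: "y \<in> box x (x + h *\<^sub>R One)" for y
      proof (rule near)
        have "norm (y - x) \<le> (\<Sum>j\<in>UNIV. \<bar>(y - x) $ j\<bar>)" by (rule norm_le_l1_cart)
        also have "\<dots> \<le> (\<Sum>j\<in>(UNIV::'n set). h)"
        proof (rule sum_mono)
          fix j
          have "\<forall>k. x $ k < y $ k \<and> y $ k < (x + h *\<^sub>R One) $ k"
            using y unfolding mem_box_cart .
          then have "x $ j < y $ j \<and> y $ j < (x + h *\<^sub>R One) $ j" by blast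
          moreover have "(x + h *\<^sub>R One) $ j = x $ j + h * 1"
            by (simp only: vector_add_component vector_scaleR_component One real_scaleR_def)
          ultimately have "x $ j < y $ j" "y $ j < x $ j + h" by auto
          then show "\<bar>(y - x) $ j\<bar> \<le> h" by simp
        qed
        also have "\<dots> = S * h" by (simp add: S_def)
        also have "\<dots> < \<rho>" using h S by (simp add: field_simps)
        finally show "dist y x < \<rho>" by (simp add: dist_norm)
      qed
      then have "\<bar>\<integral>y. u y * indicator (box x (x + h *\<^sub>R One)) y \<partial>lborel\<bar>
          \<le> C * \<omega> * measure lborel (box x (x + h *\<^sub>R One))"
        by (rule abs_integral_box_le)
      also have "measure lborel (box x (x + h *\<^sub>R One)) = h ^ CARD('n)"
        using h by (simp add: measure_lborel_box_eq inner_add_left)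
      also have "C * \<omega> = C * norm x powr - \<gamma> + \<epsilon>"
        using decay_constants_pos by (simp add: \<omega>_def algebra_simps)
      finally show "\<bar>\<integral>y. u y * indicator (box x (x + h *\<^sub>R One)) y \<partial>lborel\<bar>
        \<le> (C * norm x powr - \<gamma> + \<epsilon>) * h ^ CARD('n)" .
    qed
  qed
  then show ?thesis by simp
qed

end

section \<open>Vanishing of the tail supremum\<close>

text \<open>Both \<open>a\<close> and \<open>b\<close> are at most \<open>a + b\<close>, and the exponents add up to \<open>1\<close>.\<close>

lemma vpow_mult_powr_le_add:
  assumes "0 \<le> \<beta>" "\<beta> \<le> 1" "a \<ge> 0" "b > 0"
  shows "vpow a \<beta> * b powr (1 - \<beta>) \<le> a + b"
proof -
  have "vpow a \<beta> \<le> (a + b) powr \<beta>"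
    using assms by (auto simp: vpow_def intro: powr_mono2)
  moreover have "b powr (1 - \<beta>) \<le> (a + b) powr (1 - \<beta>)"
    using assms by (intro powr_mono2) auto
  ultimately have "vpow a \<beta> * b powr (1 - \<beta>) \<le> (a + b) powr \<beta> * (a + b) powr (1 - \<beta>)"
    by (intro mult_mono) auto
  also have "\<dots> = a + b" using assms by (simp flip: powr_add)
  finally show ?thesis .
qed

text \<open>Split \<open>\<bar>t\<bar>\<^sup>q\<close> into \<open>(t\<^sup>2)\<^sup>\<beta>\<close>, which joins \<open>v\<^sup>\<beta>\<close>, and \<open>\<bar>t\<bar>\<close> to the power \<open>q - 2 * \<beta>\<close>, which is estimated by the
decay bound.  The hypothesis \<open>exps\<close> says that the remaining power of \<open>r\<close> is
\<open>r powr - \<delta> * (r powr - n) powr (1 - \<beta>)\<close>; the previous lemma then merges \<open>(v * t\<^sup>2)\<^sup>\<beta>\<close> with its last factor.\<close>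

lemma weight_times_power_le:
  assumes \<beta>: "0 \<le> \<beta>" "\<beta> \<le> 1" and q: "q > 0" "q \<ge> 2 * \<beta>" and r: "r > 0" and v: "v \<ge> 0"
    and t: "\<bar>t\<bar> \<le> C * r powr - \<gamma>" and C: "C > 0"
    and exps: "\<alpha> - \<gamma> * (q - 2 * \<beta>) = - n * (1 - \<beta>) - \<delta>"
  shows "r powr \<alpha> * vpow v \<beta> * \<bar>t\<bar> powr q
    \<le> C powr (q - 2 * \<beta>) * r powr - \<delta> * (v * t\<^sup>2 + r powr - n)"
proof (cases "t = 0")
  case True
  then show ?thesis using q v by simp
next
  case False
  define c where "c = C powr (q - 2 * \<beta>)"
  have c: "c \<ge> 0" by (simp add: c_def)
  have split: "\<bar>t\<bar> powr q = (t\<^sup>2) powr \<beta> * \<bar>t\<bar> powr (q - 2 * \<beta>)"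
  proof -
    have "t\<^sup>2 = \<bar>t\<bar> powr 2" by simp
    then have "(t\<^sup>2) powr \<beta> = \<bar>t\<bar> powr (2 * \<beta>)" by (simp only: powr_powr)
    then show ?thesis using False by (simp flip: powr_add)
  qed
  have vt: "vpow v \<beta> * (t\<^sup>2) powr \<beta> = vpow (v * t\<^sup>2) \<beta>"
    using v False by (simp add: vpow_def powr_mult)
  have vt0: "vpow (v * t\<^sup>2) \<beta> \<ge> 0" by (simp add: vpow_def)
  have "\<bar>t\<bar> powr (q - 2 * \<beta>) \<le> (C * r powr - \<gamma>) powr (q - 2 * \<beta>)"
    using q t by (intro powr_mono2) auto
  also have "\<dots> = c * r powr (- \<gamma> * (q - 2 * \<beta>))"
    using C r by (simp add: c_def powr_mult powr_powr)
  finally have "r powr \<alpha> * vpow (v * t\<^sup>2) \<beta> * \<bar>t\<bar> powr (q - 2 * \<beta>)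
      \<le> r powr \<alpha> * vpow (v * t\<^sup>2) \<beta> * (c * r powr (- \<gamma> * (q - 2 * \<beta>)))"
    using vt0 by (intro mult_left_mono) auto
  also have "\<dots> = c * (r powr (\<alpha> - \<gamma> * (q - 2 * \<beta>)) * vpow (v * t\<^sup>2) \<beta>)"
  proof -
    have "r powr \<alpha> * r powr (- \<gamma> * (q - 2 * \<beta>)) = r powr (\<alpha> - \<gamma> * (q - 2 * \<beta>))"
      unfolding powr_add[symmetric] by simp
    note eq = this
    show ?thesis unfolding eq[symmetric] by (simp only: mult_ac)
  qed
  also have "r powr (\<alpha> - \<gamma> * (q - 2 * \<beta>)) = r powr - \<delta> * (r powr - n) powr (1 - \<beta>)"
    unfolding exps powr_powr powr_add[symmetric] by (rule arg_cong[where f = "(powr) r"]) simp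
  also have "c * (r powr - \<delta> * (r powr - n) powr (1 - \<beta>) * vpow (v * t\<^sup>2) \<beta>)
      = c * r powr - \<delta> * (vpow (v * t\<^sup>2) \<beta> * (r powr - n) powr (1 - \<beta>))"
    by (simp add: mult_ac)
  also have "\<dots> \<le> c * r powr - \<delta> * (v * t\<^sup>2 + r powr - n)"
    using c v r by (intro mult_left_mono vpow_mult_powr_le_add \<beta>) auto
  finally show ?thesis
    by (simp add: split vt[symmetric] c_def mult_ac)
qed

text \<open>A vanishing denominator would make the quotient infinite, so the bound can be multiplied out.\<close>

lemma KV_quotient_le_imp_le:
  assumes "KV_quotient V K \<alpha> \<beta> r \<le> ennreal \<Lambda>" "K r > 0" "\<Lambda> \<ge> 0"
  shows "K r \<le> \<Lambda> * (r powr \<alpha> * vpow (V r) \<beta>)"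
proof -
  define D where "D = r powr \<alpha> * vpow (V r) \<beta>"
  have D: "D \<ge> 0" by (simp add: D_def vpow_def)
  have le: "ennreal (K r) / ennreal D \<le> ennreal \<Lambda>"
    using assms(1) by (simp add: KV_quotient_def D_def)
  have "D \<noteq> 0"
  proof
    assume "D = 0"
    then have "ennreal (K r) / ennreal D = \<infinity>"
      using assms(2) by (simp add: ennreal_divide_zero)
    with le show False by (simp add: top_unique)
  qed
  with D have "D > 0" by simp
  then show ?thesis
    using le assms(2,3) by (simp add: divide_ennreal D_def[symmetric] pos_divide_le_eq)
qed

theorem theorem3p3:
  fixes V K :: "real \<Rightarrow> real" and C R\<^sub>2 \<alpha> \<beta> q\<^sub>2 :: real
  assumes "CARD('n::finite) \<ge> 3"
    and "continuous_on {0<..} V" and "\<And>r. r > 0 \<Longrightarrow> V r \<ge> 0"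
    and "continuous_on {0<..} K" and "\<And>r. r > 0 \<Longrightarrow> K r > 0"
    and "C > 0" and "\<And>r. 0 < r \<Longrightarrow> r < 1 \<Longrightarrow> V r \<le> C / r\<^sup>2"
    and "R\<^sub>2 > 0" and "0 \<le> \<beta>" and "\<beta> \<le> 1"
    and "(SUP r\<in>{R\<^sub>2<..}. KV_quotient V K \<alpha> \<beta> r) < \<infinity>"
    and "q\<^sub>2 > max 1 (max (2 * \<beta>) (q_infty_star CARD('n) \<alpha> \<beta>))"
  shows "((\<lambda>R. S_infty TYPE('n) V K q\<^sub>2 R) \<longlongrightarrow> 0) at_top"
proof -
  define n where "n = real CARD('n)"
  define \<gamma> where "\<gamma> = (n - 2) / 2"
  define D where "D = (4 + 1 / (n * unit_ball_vol n * (n - 2))) / 2"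
  \<comment> \<open>the surplus decay gained from the strict inequality for \<open>q\<^sub>2\<close>\<close>
  define \<delta> where "\<delta> = \<gamma> * (q\<^sub>2 - q_infty_star CARD('n) \<alpha> \<beta>)"
  have n: "n \<ge> 3" using assms(1) by (simp add: n_def)
  then have \<gamma>: "\<gamma> > 0" by (simp add: \<gamma>_def)
  have D: "D > 0" unfolding D_def using n by (intro divide_pos_pos add_pos_nonneg) auto
  have q: "q\<^sub>2 > 0" "q\<^sub>2 \<ge> 2 * \<beta>" "q\<^sub>2 > q_infty_star CARD('n) \<alpha> \<beta>" using assms(12) by auto
  have \<delta>: "\<delta> > 0" using \<gamma> q by (simp add: \<delta>_def)
  have "\<gamma> * q_infty_star CARD('n) \<alpha> \<beta> = \<alpha> + n - 2 * \<beta>"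
    using n by (simp add: \<gamma>_def q_infty_star_def n_def field_simps)
  then have "\<delta> = \<gamma> * q\<^sub>2 - (\<alpha> + n - 2 * \<beta>)" by (simp add: \<delta>_def right_diff_distrib)
  moreover have "2 * (\<gamma> * \<beta>) = (n - 2) * \<beta>" by (simp add: \<gamma>_def)
  ultimately have exps: "\<alpha> - \<gamma> * (q\<^sub>2 - 2 * \<beta>) = - n * (1 - \<beta>) - \<delta>"
    by (simp add: algebra_simps)
  obtain \<Lambda> where \<Lambda>: "\<Lambda> \<ge> 0" "(SUP r\<in>{R\<^sub>2<..}. KV_quotient V K \<alpha> \<beta> r) = ennreal \<Lambda>"
    using assms(11) by (cases "(SUP r\<in>{R\<^sub>2<..}. KV_quotient V K \<alpha> \<beta> r)") auto
  have K_le: "K r \<le> \<Lambda> * (r powr \<alpha> * vpow (V r) \<beta>)" if "r > R\<^sub>2" for r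
  proof (rule KV_quotient_le_imp_le)
    show "KV_quotient V K \<alpha> \<beta> r \<le> ennreal \<Lambda>"
      unfolding \<Lambda>(2)[symmetric] using that by (intro SUP_upper) simp
  qed (use that assms(5,8) \<Lambda>(1) in auto)
  define B where "B = \<Lambda> * D powr (q\<^sub>2 - 2 * \<beta>)"
  have B: "B \<ge> 0" using \<Lambda> by (simp add: B_def)
  define c where "c = n * unit_ball_vol n / (\<delta> / 2)"
  have c: "c \<ge> 0" using n \<delta> by (simp add: c_def)
  have key: "S_infty TYPE('n) V K q\<^sub>2 R \<le> ennreal (B * R powr - (\<delta> / 2) * (12 + c))"
    if R: "R \<ge> 1" "R > R\<^sub>2" "D * R powr - \<gamma> \<le> 1" for R
    unfolding S_infty_def
  proof (rule SUP_least)
    fix u :: "real^'n \<Rightarrow> real" assume "u \<in> {u \<in> E V. norm_E V u = 1}"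
    then have u: "u \<in> D12_r" and norm: "norm_E V u = 1" by (auto simp: E_def)
    have um[measurable]: "u \<in> borel_measurable lborel"
      using u by (auto simp: D12_r_def D12_def)
    have "norm_o V u \<le> norm_E V u" "ennreal (norm12 u) \<le> norm_E V u"
      by (auto simp: norm_E_def add_increasing add_increasing2)
    then have o: "norm_o V u \<le> 1" and u1: "norm12 u \<le> 1"
      using norm by (auto simp: ennreal_le_1)
    have decay: "AE x in lborel. x \<noteq> 0 \<longrightarrow> \<bar>u x\<bar> \<le> D * norm x powr - \<gamma>"
      using D12_r_decay[OF assms(1) u u1] by (simp add: D_def \<gamma>_def n_def)
    have small: "AE x in lborel. norm x \<ge> R \<longrightarrow> \<bar>u x\<bar> \<le> 1"
      using decay
    proof eventually_elim
      case (elim x)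
      show ?case
      proof
        assume x: "norm x \<ge> R"
        then have "D * norm x powr - \<gamma> \<le> D * R powr - \<gamma>"
          using R \<gamma> D by (intro mult_left_mono powr_mono2') auto
        moreover have "x \<noteq> 0" using x R by auto
        ultimately show "\<bar>u x\<bar> \<le> 1" using elim R by linarith
      qed
    qed
    define d where "d = B * R powr - (\<delta> / 2)"
    have d: "d \<ge> 0" using B by (simp add: d_def)
    have [measurable]: "(\<lambda>x::real^'n. indicator (- ball 0 R) x * V (norm x)) \<in> borel_measurable borel"
      by (rule radial_outside_ball_measurable[OF assms(2)]) (use R in auto)
    have Vu_meas: "(\<lambda>x. ennreal (V (norm x) * (u x)\<^sup>2) * indicator (- ball 0 R) x) \<in> borel_measurable lborel"
    proof -
      have "(\<lambda>x. ennreal (indicator (- ball 0 R) x * V (norm x) * (u x)\<^sup>2)) \<in> borel_measurable lborel"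
        by measurable
      also have "(\<lambda>x. ennreal (indicator (- ball 0 R) x * V (norm x) * (u x)\<^sup>2))
          = (\<lambda>x. ennreal (V (norm x) * (u x)\<^sup>2) * indicator (- ball 0 R) x)"
        by (rule ext) (simp split: split_indicator)
      finally show ?thesis .
    qed
    have "(\<integral>\<^sup>+x\<in>- ball 0 R. ennreal (K (norm x) * \<bar>u x\<bar> powr q\<^sub>2) \<partial>lborel)
      \<le> (\<integral>\<^sup>+x. ennreal d * (ennreal (V (norm x) * (u x)\<^sup>2) * indicator (- ball 0 R) x
          + ennreal (norm x powr (- n - \<delta> / 2)) * indicator (- ball 0 1) x) \<partial>lborel)"
    proof (rule nn_integral_mono_AE, use decay in eventually_elim)
      case (elim x)
      show ?case
      proof (cases "x \<in> - ball 0 R")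
        case True
        define r where "r = norm x"
        have r: "r \<ge> R" "r > 0" "r \<ge> 1" "r > R\<^sub>2" "x \<noteq> 0"
          using True R by (auto simp: r_def)
        have V: "V r \<ge> 0" using assms(3) r by simp
        have "K r * \<bar>u x\<bar> powr q\<^sub>2 \<le> \<Lambda> * (r powr \<alpha> * vpow (V r) \<beta>) * \<bar>u x\<bar> powr q\<^sub>2"
          by (intro mult_right_mono K_le r) simp
        also have "\<dots> = \<Lambda> * (r powr \<alpha> * vpow (V r) \<beta> * \<bar>u x\<bar> powr q\<^sub>2)" by simp
        also have "\<dots> \<le> \<Lambda> * (D powr (q\<^sub>2 - 2 * \<beta>) * r powr - \<delta> * (V r * (u x)\<^sup>2 + r powr - n))"
          using elim r
          by (intro mult_left_mono weight_times_power_le[OF assms(9,10) q(1,2) r(2) V _ D exps] \<Lambda>(1))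
             (simp add: r_def)
        also have "\<dots> = B * (r powr - \<delta> * (V r * (u x)\<^sup>2 + r powr - n))" by (simp add: B_def)
        also have "\<dots> \<le> B * (R powr - (\<delta> / 2) * (V r * (u x)\<^sup>2 + r powr (- n - \<delta> / 2)))"
        proof (rule mult_left_mono[OF _ B])
          \<comment> \<open>half of the decay gives smallness in \<open>R\<close>, the other half makes the power of \<open>r\<close> integrable\<close>
          define s where "s = r powr - (\<delta> / 2)"
          have "s \<le> 1 powr - (\<delta> / 2)" "s \<le> R powr - (\<delta> / 2)"
            unfolding s_def using r R \<delta> by (intro powr_mono2'; simp)+
          then have s: "0 \<le> s" "s \<le> 1" "s \<le> R powr - (\<delta> / 2)" by (simp_all add: s_def)
          have "r powr - \<delta> = s * s" using r by (simp add: s_def flip: powr_add)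
          moreover have "r powr (- n - \<delta> / 2) = s * r powr - n"
            unfolding s_def powr_add[symmetric] by (rule arg_cong[where f = "(powr) r"]) simp
          moreover have "s * (V r * (u x)\<^sup>2) \<le> 1 * (V r * (u x)\<^sup>2)"
            using s V by (intro mult_right_mono) auto
          ultimately have "r powr - \<delta> * (V r * (u x)\<^sup>2 + r powr - n)
              \<le> s * (V r * (u x)\<^sup>2 + r powr (- n - \<delta> / 2))"
            using s mult_left_mono[of "s * (V r * (u x)\<^sup>2)" "V r * (u x)\<^sup>2" s]
            by (simp add: algebra_simps)
          also have "\<dots> \<le> R powr - (\<delta> / 2) * (V r * (u x)\<^sup>2 + r powr (- n - \<delta> / 2))"
            using s V by (intro mult_right_mono) auto
          finally show "r powr - \<delta> * (V r * (u x)\<^sup>2 + r powr - n)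
              \<le> R powr - (\<delta> / 2) * (V r * (u x)\<^sup>2 + r powr (- n - \<delta> / 2))" .
        qed
        also have "\<dots> = d * (V r * (u x)\<^sup>2 + r powr (- n - \<delta> / 2))" by (simp add: d_def)
        finally have "ennreal (K r * \<bar>u x\<bar> powr q\<^sub>2) \<le> ennreal (d * (V r * (u x)\<^sup>2 + r powr (- n - \<delta> / 2)))"
          by (rule ennreal_leI)
        also have "\<dots> = ennreal d * (ennreal (V r * (u x)\<^sup>2) + ennreal (r powr (- n - \<delta> / 2)))"
        proof -
          have "V r * (u x)\<^sup>2 \<ge> 0" using V by simp
          then show ?thesis using d by (simp only: ennreal_plus[symmetric] ennreal_mult powr_ge_zero add_nonneg_nonneg)
        qed
        finally show ?thesis using True r by (simp add: r_def)
      qed simp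
    qed
    also have "\<dots> = ennreal d * ((\<integral>\<^sup>+x\<in>- ball 0 R. ennreal (V (norm x) * (u x)\<^sup>2) \<partial>lborel)
        + (\<integral>\<^sup>+x\<in>- ball 0 1. ennreal (norm (x::real^'n) powr (- n - \<delta> / 2)) \<partial>lborel))"
      using Vu_meas by (subst nn_integral_cmult, simp, subst nn_integral_add) auto
    also have "\<dots> \<le> ennreal d * (12 + ennreal c)"
    proof (intro mult_left_mono add_mono)
      show "(\<integral>\<^sup>+x\<in>- ball 0 R. ennreal (V (norm x) * (u x)\<^sup>2) \<partial>lborel) \<le> 12"
        using tail_integral_le_12[OF assms(2,3) um o _ small] R by simp
      show "(\<integral>\<^sup>+x\<in>- ball 0 1. ennreal (norm (x::real^'n) powr (- n - \<delta> / 2)) \<partial>lborel) \<le> ennreal c"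
        unfolding n_def c_def using \<delta> by (subst tail_integral_powr) auto
    qed auto
    also have "12 + ennreal c = ennreal (12 + c)" using c by (simp add: ennreal_plus)
    also have "ennreal d * ennreal (12 + c) = ennreal (d * (12 + c))"
      using c d by (intro ennreal_mult[symmetric]) auto
    finally show "(\<integral>\<^sup>+x\<in>- ball 0 R. ennreal (K (norm x) * \<bar>u x\<bar> powr q\<^sub>2) \<partial>lborel)
      \<le> ennreal (B * R powr - (\<delta> / 2) * (12 + c))" by (simp add: d_def)
  qed
  have lim: "((\<lambda>R::real. R powr - s) \<longlongrightarrow> 0) at_top" if "s > 0" for s
    using that by (intro tendsto_neg_powr filterlim_ident) auto
  have "((\<lambda>R. B * R powr - (\<delta> / 2) * (12 + c)) \<longlongrightarrow> 0) at_top"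
    using \<delta> by (intro tendsto_mult_left_zero tendsto_mult_right_zero lim) simp
  then have bound_lim: "((\<lambda>R. ennreal (B * R powr - (\<delta> / 2) * (12 + c))) \<longlongrightarrow> 0) at_top"
    using tendsto_ennrealI by fastforce
  have "((\<lambda>R. D * R powr - \<gamma>) \<longlongrightarrow> 0) at_top"
    by (intro tendsto_mult_right_zero lim \<gamma>)
  then have "\<forall>\<^sub>F R in at_top. D * R powr - \<gamma> < 1"
    by (rule order_tendstoD) simp
  then have upper: "\<forall>\<^sub>F R in at_top.
      S_infty TYPE('n) V K q\<^sub>2 R \<le> ennreal (B * R powr - (\<delta> / 2) * (12 + c))"
    using eventually_ge_at_top[of 1] eventually_gt_at_top[of R\<^sub>2]
  proof eventually_elim
    case (elim R)
    then show ?case by (intro key) simp_all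
  qed
  show ?thesis
    by (rule tendsto_sandwich[OF _ upper tendsto_const bound_lim]) simp
qed

end
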